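(* Consider the dual-machine online power-down scheduling problem described in the context, with turn-on cost $E=1$, busy power $\psi_b=1$ and idle power $\psi_\sigma\le 1$. For margin $u=0.5$, Algorithm $\mathcal{A}$ is correct, i.e. for every online job sequence satisfying the single-machine schedulability condition it completes every job $j$ within $[a_j,d_j]$, and its competitive ratio is at most $3$: for every such input, the total energy consumed by $\mathcal{A}$ is at most $3$ times the energy consumed by an optimal offline schedule on a single machine.
   Context: Problem. There are two identical machines. Each machine is at any time in one of the states sleep (OFF), idle, or busy (idle and busy together count as ON). Switching a machine from sleep to idle or busy costs $E=1$ unit of energy; a busy machine consumes $\psi_b=1$ unit of energy per unit time and an idle machine consumes $\psi_\sigma$ per unit time, where $0<\psi_\sigma\le 1$; a sleeping machine consumes nothing. Jobs $j=(a_j,d_j,c_j)$ arrive online: job $j$ becomes known at its arrival time $a_j$, must receive $c_j$ units of processing within $[a_j,d_j]$, may be preempted, but must be processed entirely on one machine (no migration). The input is guaranteed to satisfy the single-machine schedulability condition: for every interval $(\ell,r)$, $\sum_{j:\,\ell\le a_j,\ d_j\le r} c_j\le r-\ell$ (equivalently, all jobs can be feasibly scheduled on a single machine by earliest-deadline-first, EDF). The cost of a schedule is its total energy (turn-on costs plus busy and idle consumption). The offline optimum OPT is a minimum-energy feasible schedule of all jobs on a single machine, knowing the whole input in advance. An online algorithm has competitive ratio at most $r$ if its cost is at most $r$ times OPT's cost on every input. Notation for the algorithm. The two machines carry logical names $M_P$ (primary) and $M_S$ (secondary); names may be swapped. $Q$ is a queue of pending unscheduled jobs (a job arriving while no machine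 is on is placed in $Q$); $Q_{M_P}$ and $Q_{M_S}$ are queues of jobs assigned to $M_P$, $M_S$, each executed on its machine by EDF; finished jobs are removed. $c'_j(t)$ is the remaining processing time of job $j$ at time $t$, and $W(t,t^\dagger)=\sum_{j} c'_j(t)$, the sum over the jobs (of the relevant queue) not finished by time $t$ whose deadline is at most $t^\dagger$. A machine is "available" for a new job $j$ at time $t$ if there is no $t^*$ with $W(t,t^* )>t^*-t$ for the jobs in its queue together with $j$. The margin is a constant $u>0$. Algorithm $\mathcal{A}$ (at each time $t$): Initially assign the names $M_P,M_S$ arbitrarily. (1a) If no machine is on and there exist $t^\dagger,t^*$ with $W(t^\dagger,t^* )\ge t^*-t^\dagger$ (for the jobs in $Q$) and $t\ge t^\dagger-u$, turn on $M_P$ and move all jobs of $Q$ into $Q_{M_P}$. (1b) If only $M_P$ is on and a new job $j$ arrives: if $M_P$ is available, add $j$ to $Q_{M_P}$ and reschedule by EDF; otherwise turn on the other machine $M_S$, put $j$ into the (empty) $Q_{M_S}$, and then swap the names $M_P$ and $M_S$. (1c) If $M_S$ is on and a new job $j$ arrives: if $M_S$ is available, add $j$ to $Q_{M_S}$ and reschedule by EDF; otherwise add $j$ to $Q_{M_P}$. (2a) $M_S$ is turned off immediately when $Q_{M_S}$ becomes empty (it never idles). (2b) $M_P$ becomes idle when $Q_{M_P}$ becomes empty, and is turned off when its total idle time reaches $2/\psi_\sigma$.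
   Formalization: Rule (1a) is corrected: if an arriving job triggers it, M_P starts with the jobs already in Q and the new job is handled by (1b); literally, (0,10,8) then (1,3,2) misses a deadline. In (1c), an M_P already turned off by (2b) is turned on again (cost counted) when it receives a job. *)

theory Defs
  imports "HOL-Analysis.Analysis"
begin

section \<open>Jobs, schedules and energy\<close>

text \<open>The identifier only keeps jobs with equal parameters apart.\<close>

datatype job = Job (jid: nat) (arr: real) (dl: real) (proc: real)

definition job_sequence :: "job list \<Rightarrow> bool" where
  "job_sequence js \<longleftrightarrow> distinct js \<and> sorted (map arr js) \<and> (\<forall>j\<in>set js. 0 < proc j)"

definition single_machine_schedulable :: "job set \<Rightarrow> bool" where
  "single_machine_schedulable J \<longleftrightarrow>
     (\<forall>l r. l < r \<longrightarrow> (\<Sum>j\<in>{j \<in> J. l \<le> arr j \<and> dl j \<le> r}. proc j) \<le> r - l)"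

datatype mode = Sleep | Idle | Busy job

text \<open>A schedule on a set \<open>'m\<close> of machines gives the mode of every machine at every time.\<close>

type_synonym 'm schedule = "'m \<Rightarrow> real \<Rightarrow> mode"

text \<open>Right-continuous step functions with finitely many jumps.\<close>

definition step_fun :: "(real \<Rightarrow> mode) \<Rightarrow> bool" where
  "step_fun f \<longleftrightarrow> (\<exists>B. finite B \<and> (\<forall>s t. s \<le> t \<and> {s<..t} \<inter> B = {} \<longrightarrow> f s = f t))"

text \<open>Preemption is allowed, migration is not.\<close>

definition feasible :: "job set \<Rightarrow> 'm schedule \<Rightarrow> bool" where
  "feasible J \<sigma> \<longleftrightarrow>
     (\<forall>m. step_fun (\<sigma> m)) \<and>
     (\<forall>m t j. \<sigma> m t = Busy j \<longrightarrow> j \<in> J \<and> t \<in> {arr j..dl j}) \<and>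
     (\<forall>j\<in>J. \<exists>m. emeasure lborel {t. \<sigma> m t = Busy j} = ennreal (proc j) \<and>
                 (\<forall>m'. m' \<noteq> m \<longrightarrow> (\<forall>t. \<sigma> m' t \<noteq> Busy j)))"

definition turn_ons :: "(real \<Rightarrow> mode) \<Rightarrow> real set" where
  "turn_ons f = {t. f t \<noteq> Sleep \<and> (\<forall>\<^sub>F s in at_left t. f s = Sleep)}"

text \<open>Turn-on cost and busy power are both 1; \<open>\<psi>\<close> is the idle power.\<close>

definition machine_energy :: "real \<Rightarrow> (real \<Rightarrow> mode) \<Rightarrow> ennreal" where
  "machine_energy \<psi> f =
     of_nat (card (turn_ons f))
     + emeasure lborel {t. \<exists>j. f t = Busy j}
     + ennreal \<psi> * emeasure lborel {t. f t = Idle}"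

definition energy :: "real \<Rightarrow> ('m::finite) schedule \<Rightarrow> ennreal" where
  "energy \<psi> \<sigma> = (\<Sum>m\<in>UNIV. machine_energy \<psi> (\<sigma> m))"

text \<open>The type \<open>unit\<close> stands for the single machine of the offline optimum.\<close>

definition opt_energy :: "real \<Rightarrow> job set \<Rightarrow> ennreal" where
  "opt_energy \<psi> J = (INF \<sigma> \<in> {\<sigma> :: unit schedule. feasible J \<sigma>}. energy \<psi> \<sigma>)"


section \<open>The online algorithm\<close>

datatype machine = M1 | M2

instance machine :: finite
proof
  have "UNIV \<subseteq> {M1, M2}"
    using machine.exhaust by auto
  then show "finite (UNIV :: machine set)"
    by (rule finite_subset) simp
qed

fun other :: "machine \<Rightarrow> machine" where
  "other M1 = M2"
| "other M2 = M1"

text \<open>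
  A queue lists the unfinished jobs together with their remaining processing times, in order
  of deadlines, so that EDF always executes the head.
\<close>

type_synonym queue = "(job \<times> real) list"

definition enqueue :: "job \<Rightarrow> queue \<Rightarrow> queue" where
  "enqueue j q = insort_key (\<lambda>(i, _). dl i) (j, proc j) q"

definition workload :: "queue \<Rightarrow> real" where
  "workload q = (\<Sum>(j, r)\<leftarrow>q. r)"

text \<open>The function \<open>W(t, t\<^sup>*)\<close>, for the queue as it is at time \<open>t\<close>.\<close>

definition W :: "queue \<Rightarrow> real \<Rightarrow> real" where
  "W q t' = workload (filter (\<lambda>(j, _). dl j \<le> t') q)"

text \<open>
  The restrictions \<open>t \<le> t'\<close> and \<open>s < t'\<close> below only exclude choices for which the inequality
  holds trivially.
\<close>

definition available :: "queue \<Rightarrow> real \<Rightarrow> job \<Rightarrow> bool" where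
  "available q t j \<longleftrightarrow> \<not> (\<exists>t'\<ge>t. W (enqueue j q) t' > t' - t)"

text \<open>
  The trigger of rule (1a) with margin \<open>u\<close>, where \<open>s\<close> is the time written \<open>t\<dagger>\<close> in the algorithm.
  It is only used for the queue of unscheduled jobs, whose remaining processing times do not
  change until a machine is turned on, hence \<open>W\<close> does not depend on \<open>s\<close>.
\<close>

definition urgent :: "real \<Rightarrow> queue \<Rightarrow> real \<Rightarrow> bool" where
  "urgent u q t \<longleftrightarrow> (\<exists>s t'. s < t' \<and> W q t' \<ge> t' - s \<and> t \<ge> s - u)"

text \<open>
  The physical machine called \<open>M\<^sub>P\<close> is \<open>prim\<close>, the other one is \<open>M\<^sub>S\<close>.  The total idle time of
  \<open>M\<^sub>P\<close> is counted from the moment at which it was last turned on.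
\<close>

record state =
  clock :: real
  prim :: machine
  onP :: bool
  onS :: bool
  Q :: queue
  QP :: queue
  QS :: queue
  idleP :: real

definition init :: "machine \<Rightarrow> state" where
  "init m = \<lparr>clock = 0, prim = m, onP = False, onS = False,
             Q = [], QP = [], QS = [], idleP = 0\<rparr>"

definition rule_1a :: "state \<Rightarrow> state" where
  "rule_1a st = st\<lparr>onP := True, idleP := 0, QP := Q st, Q := []\<rparr>"

definition rule_1b :: "job \<Rightarrow> state \<Rightarrow> state" where
  "rule_1b j st =
     (if available (QP st) (clock st) j
      then st\<lparr>QP := enqueue j (QP st)\<rparr>
      else st\<lparr>prim := other (prim st), onS := True, QS := QP st,
              QP := enqueue j [], idleP := 0\<rparr>)"

text \<open>
  \<open>M\<^sub>P\<close> may have been turned off by (2b) while \<open>M\<^sub>S\<close> is still working; it is then turned on again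
  when a job is put into its queue.
\<close>

definition rule_1c :: "job \<Rightarrow> state \<Rightarrow> state" where
  "rule_1c j st =
     (if available (QS st) (clock st) j
      then st\<lparr>QS := enqueue j (QS st)\<rparr>
      else st\<lparr>QP := enqueue j (QP st), onP := True,
              idleP := (if onP st then idleP st else 0)\<rparr>)"

text \<open>
  If no machine is on and the arriving job itself triggers (1a), then \<open>M\<^sub>P\<close> is turned on with
  the jobs that were already pending, and the arriving job is dispatched by (1b).  When all
  these jobs fit on \<open>M\<^sub>P\<close>, this puts all of them into the queue of \<open>M\<^sub>P\<close>.  They need not fit:
  if the job \<open>(0, 10, 8)\<close> is pending and \<open>(1, 3, 2)\<close> arrives, then 10 units of work are due
  within the remaining 9 time units, although both jobs can be scheduled on one machine
  from time 0 on.
\<close>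

definition arrive :: "real \<Rightarrow> job \<Rightarrow> state \<Rightarrow> state" where
  "arrive u j st =
     (if onS st then rule_1c j st
      else if onP st then rule_1b j st
      else if urgent u (enqueue j (Q st)) (clock st) then rule_1b j (rule_1a st)
      else st\<lparr>Q := enqueue j (Q st)\<rparr>)"

text \<open>What remains of a queue when its machine has executed it by EDF for \<open>\<delta>\<close> time units.\<close>

fun serve :: "real \<Rightarrow> queue \<Rightarrow> queue" where
  "serve \<delta> [] = []"
| "serve \<delta> ((j, r) # q) = (if r \<le> \<delta> then serve (\<delta> - r) q else (j, r - \<delta>) # q)"

text \<open>
  The machines that are on run until time \<open>t\<close> without arrivals.  They are turned off by (2a)
  and (2b) if this is due strictly before \<open>t\<close>.  A switch-off due exactly at \<open>t\<close> is left to
  \<open>switch_off\<close>, which takes place after the arrivals at time \<open>t\<close>; so no machine is turned off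
  and on again at the same instant.
\<close>

definition work_until :: "real \<Rightarrow> real \<Rightarrow> state \<Rightarrow> state" where
  "work_until \<psi> t st =
     (let \<delta> = t - clock st;
          i = idleP st + max 0 (\<delta> - workload (QP st))
      in st\<lparr>clock := t,
            onP := (onP st \<and> i \<le> 2 / \<psi>),
            onS := (onS st \<and> \<delta> \<le> workload (QS st)),
            QP := serve \<delta> (QP st),
            QS := serve \<delta> (QS st),
            idleP := i\<rparr>)"

definition switch_off :: "real \<Rightarrow> state \<Rightarrow> state" where
  "switch_off \<psi> st =
     st\<lparr>onS := (onS st \<and> QS st \<noteq> []),
        onP := (onP st \<and> \<not> (QP st = [] \<and> idleP st \<ge> 2 / \<psi>))\<rparr>"

text \<open>
  The evolution until time \<open>t\<close> without arrivals; if no machine is on, rule (1a) fires at the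
  first moment at which its condition holds.  Jobs are pending in \<open>Q\<close> only while both machines
  are off, so (1a) can fire only once.
\<close>

definition elapse :: "real \<Rightarrow> real \<Rightarrow> real \<Rightarrow> state \<Rightarrow> state" where
  "elapse \<psi> u t st =
     (if onP st \<or> onS st then work_until \<psi> t st
      else if \<exists>s\<in>{clock st..t}. urgent u (Q st) s
      then work_until \<psi> t (rule_1a (st\<lparr>clock := Inf {s. clock st \<le> s \<and> urgent u (Q st) s}\<rparr>))
      else st\<lparr>clock := t\<rparr>)"

text \<open>
  The state at time \<open>t\<close>; only the jobs that have arrived by then are used.  Jobs with equal
  arrival times are handled in the order of the list.
\<close>

definition state_at :: "real \<Rightarrow> real \<Rightarrow> machine \<Rightarrow> job list \<Rightarrow> real \<Rightarrow> state" where
  "state_at \<psi> u m js t =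
     switch_off \<psi> (elapse \<psi> u t
       (fold (\<lambda>j st. arrive u j (elapse \<psi> u (arr j) st)) (filter (\<lambda>j. arr j \<le> t) js) (init m)))"

definition current_mode :: "bool \<Rightarrow> queue \<Rightarrow> mode" where
  "current_mode is_on q =
     (if \<not> is_on then Sleep else case q of [] \<Rightarrow> Idle | (j, _) # _ \<Rightarrow> Busy j)"

text \<open>
  The schedule produced by the algorithm with idle power \<open>\<psi>\<close> and margin \<open>u\<close>, where machine
  \<open>m\<close> initially carries the name \<open>M\<^sub>P\<close>.
\<close>

definition algA :: "real \<Rightarrow> real \<Rightarrow> machine \<Rightarrow> job list \<Rightarrow> machine schedule" where
  "algA \<psi> u m js m' t =
     (let st = state_at \<psi> u m js t
      in if m' = prim st then current_mode (onP st) (QP st) else current_mode (onS st) (QS st))"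

end

theory Submission
  imports Defs
begin

text \<open>
  Call a maximal period in which the algorithm has a machine on a phase.  A machine that never
  had to wait before working on its queue is EDF-feasible by the single-machine condition, so a
  job can be refused only by a machine that has been busy, since the start \<open>\<tau>\<close> of the phase,
  with work due by some \<open>x \<ge> \<tau> + 1/2\<close> that was partly pending at time \<open>\<tau>\<close>.  Hence the names are
  swapped at most once per phase, before any idling, and then more than \<open>x - \<tau> \<ge> 1/2\<close> units of
  work are due by \<open>x\<close>.  So besides processing a phase costs 3 if there is no swap, and
  \<open>4 + 3 r\<close> if there is one and the primary machine is turned on again \<open>r\<close> times afterwards; in
  the latter case \<open>x - \<tau> \<ge> 2 r / \<psi>\<close>, since between two turn-ons it idles for \<open>2 / \<psi>\<close>.

  For the optimum, let \<open>first U\<close> be the first time at which it works on a job that arrives after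
  the previous phase.  Urgency gives \<open>first U \<le> \<tau> + 1/2\<close>, and \<open>first U \<le> \<tau>\<close> if there is a swap.
  Between two consecutive such times the optimum either turns on, and then the work due by \<open>x\<close>
  pays for the remaining \<open>1 + 3 r\<close>, or it stays on for a whole phase, which is long enough for
  its idle and busy energy to pay.
\<close>

text \<open>The margin u = 1/2 is squeezed from both sides. In a phase without a swap the primary
  machine idles for \<open>2 / \<psi>\<close>; an optimum that stays on meanwhile is only known to
  do so for \<open>2 / \<psi> - u\<close>, as it may start up to u after \<tau>. Each unit of time
  is worth at least \<open>2 * \<psi>\<close>, so \<open>4 - 2 * \<psi> * u\<close> must reach 3,
  and \<psi> = 1 forces u \<le> 1/2. A swap costs one more turn-on, charged to at least u units of
  optimal processing that are worth 2 each, so u \<ge> 1/2. Processing is worth 2 and not 3 because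
  the algorithm processes exactly as much as the optimum, which takes one of the three units.

  The optimum may start long before \<tau>, so \<open>first U\<close> has only an upper bound in
  terms of the phase that serves U; the lower bound comes from the arrivals in U. Hence a phase is
  charged to the stretch from its own \<open>first\<close> to the next one, and the very first
  turn-on of the optimum is left over to pay for the newest phase.\<close>

section \<open>Queues\<close>

definition wf_queue :: "queue \<Rightarrow> bool" where
  "wf_queue q \<longleftrightarrow> sorted (map (\<lambda>(j, _). dl j) q) \<and> (\<forall>(j, r)\<in>set q. 0 < r)"

text \<open>A sum over the entries instead of a lookup: it is additive under \<open>enqueue\<close>
  without the assumption that a job occurs only once in a queue.\<close>

definition remaining :: "queue \<Rightarrow> job \<Rightarrow> real" where
  "remaining q j = (\<Sum>(i, r)\<leftarrow>q. if i = j then r else 0)"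

lemma wf_queue_Nil [simp]: "wf_queue []"
  by (simp add: wf_queue_def)

lemma wf_queue_Cons:
  "wf_queue ((j, r) # q) \<longleftrightarrow> 0 < r \<and> (\<forall>(i, _)\<in>set q. dl j \<le> dl i) \<and> wf_queue q"
  by (auto simp: wf_queue_def)

lemma workload_simps [simp]:
  "workload [] = 0" "workload ((j, r) # q) = r + workload q"
  by (simp_all add: workload_def)

lemma W_simps [simp]:
  "W [] x = 0" "W ((j, r) # q) x = (if dl j \<le> x then r else 0) + W q x"
  by (simp_all add: W_def)

lemma remaining_simps [simp]:
  "remaining [] j = 0" "remaining ((i, r) # q) j = (if i = j then r else 0) + remaining q j"
  by (simp_all add: remaining_def)

lemma workload_nonneg: "wf_queue q \<Longrightarrow> 0 \<le> workload q"
  by (induction q) (auto simp: wf_queue_Cons)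

lemma W_nonneg: "wf_queue q \<Longrightarrow> 0 \<le> W q x"
  by (induction q) (auto simp: wf_queue_Cons)

lemma W_ge: "wf_queue q \<Longrightarrow> (j, r) \<in> set q \<Longrightarrow> r \<le> W q (dl j)"
proof (induction q)
  case (Cons a q)
  obtain i r' where a: "a = (i, r')" by force
  show ?case
  proof (cases "(j, r) = a")
    case True
    then show ?thesis using Cons.prems W_nonneg[of q "dl j"] a by (auto simp: wf_queue_Cons)
  next
    case False
    then have "r \<le> W q (dl j)" using Cons a by (auto simp: wf_queue_Cons)
    then show ?thesis using Cons.prems a by (auto simp: wf_queue_Cons)
  qed
qed simp

lemma W_later: "\<forall>(i, _)\<in>set q. x < dl i \<Longrightarrow> W q x = 0"
  by (induction q) auto

lemma remaining_notin: "j \<notin> fst ` set q \<Longrightarrow> remaining q j = 0"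
  by (induction q) auto

lemma set_enqueue: "set (enqueue j q) = insert (j, proc j) (set q)"
  by (simp add: enqueue_def set_insort_key)

lemma enqueue_not_Nil [simp]: "enqueue j q \<noteq> []"
  using set_enqueue[of j q] by (metis empty_not_insert set_empty2)

lemma wf_queue_enqueue: "wf_queue q \<Longrightarrow> 0 < proc j \<Longrightarrow> wf_queue (enqueue j q)"
  by (auto simp: wf_queue_def set_enqueue) (simp add: enqueue_def sorted_insort_key)

lemma W_enqueue: "W (enqueue j q) x = W q x + (if dl j \<le> x then proc j else 0)"
proof -
  have "W (insort_key (\<lambda>(i, _). dl i) (j, p) q) x = W q x + (if dl j \<le> x then p else 0)" for p
    by (induction q) auto
  then show ?thesis by (simp add: enqueue_def)
qed

lemma remaining_enqueue: "remaining (enqueue j q) i = remaining q i + (if i = j then proc j else 0)"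
proof -
  have "remaining (insort_key (\<lambda>(i, _). dl i) (j, p) q) i = remaining q i + (if i = j then p else 0)" for p
    by (induction q) auto
  then show ?thesis by (simp add: enqueue_def)
qed

lemma serve_eq_Nil_iff: "wf_queue q \<Longrightarrow> 0 \<le> \<delta> \<Longrightarrow> serve \<delta> q = [] \<longleftrightarrow> workload q \<le> \<delta>"
  by (induction \<delta> q rule: serve.induct) (auto simp: wf_queue_Cons dest: workload_nonneg)

lemma fst_set_serve: "fst ` set (serve \<delta> q) \<subseteq> fst ` set q"
proof (induction \<delta> q rule: serve.induct)
  case (2 \<delta> j r q)
  then show ?case by (cases "r \<le> \<delta>") auto
qed simp

lemma wf_queue_serve: "wf_queue q \<Longrightarrow> wf_queue (serve \<delta> q)"
  by (induction \<delta> q rule: serve.induct) (auto simp: wf_queue_Cons)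

text \<open>Since a queue is served in the order of deadlines, the work due by \<open>x\<close> is served first.\<close>

lemma W_serve: "wf_queue q \<Longrightarrow> 0 \<le> \<delta> \<Longrightarrow> W (serve \<delta> q) x = max 0 (W q x - \<delta>)"
proof (induction \<delta> q rule: serve.induct)
  case (2 \<delta> j r q)
  then have wf: "wf_queue q" "0 < r" "\<forall>(i, _)\<in>set q. dl j \<le> dl i"
    by (auto simp: wf_queue_Cons)
  show ?case
  proof (cases "dl j \<le> x")
    case True
    then show ?thesis using 2 wf W_nonneg[OF wf(1), of x] by auto
  next
    case False
    then have "W q x = 0" using wf(3) by (intro W_later) auto
    then show ?thesis using 2 wf False by auto
  qed
qed auto

lemma remaining_serve_le: "wf_queue q \<Longrightarrow> 0 \<le> \<delta> \<Longrightarrow> remaining (serve \<delta> q) j \<le> remaining q j"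
  by (induction \<delta> q rule: serve.induct) (auto simp: wf_queue_Cons)


section \<open>The modes of a machine between two events\<close>

text \<open>
  The mode at time \<open>s\<close> of a machine that at time \<open>c\<close> has the queue \<open>q\<close> and is allowed to idle
  for \<open>\<beta>\<close> more time units.
\<close>

definition run :: "queue \<Rightarrow> real \<Rightarrow> real \<Rightarrow> real \<Rightarrow> mode" where
  "run q \<beta> c s =
     (case serve (s - c) q of (j, _) # _ \<Rightarrow> Busy j
      | [] \<Rightarrow> if s - c < workload q + \<beta> then Idle else Sleep)"

lemma run_Nil: "run [] \<beta> c s = (if s - c < \<beta> then Idle else Sleep)"
  by (simp add: run_def)

lemma run_Cons:
  "run ((j, r) # q) \<beta> c s = (if s < c + r then Busy j else run q \<beta> (c + r) s)"
  by (simp add: run_def algebra_simps)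

lemma run_eq_Sleep_iff:
  assumes "wf_queue q" "0 \<le> \<beta>" "c \<le> s"
  shows "run q \<beta> c s = Sleep \<longleftrightarrow> c + workload q + \<beta> \<le> s"
  using assms
proof (induction q arbitrary: c)
  case (Cons a q)
  obtain j r where "a = (j, r)" by force
  with Cons show ?case
    using workload_nonneg[of q] by (auto simp: run_Cons wf_queue_Cons algebra_simps)
qed (auto simp: run_Nil)

lemma run_eq_BusyD:
  assumes "run q \<beta> c s = Busy j"
  shows "\<exists>r q'. serve (s - c) q = (j, r) # q'"
  using assms by (auto simp: run_def split: list.splits if_splits)

lemma run_Idle:
  assumes "wf_queue q" "0 \<le> \<beta>" "0 \<le> \<delta>"
  shows "{s. c \<le> s \<and> s < c + \<delta> \<and> run q \<beta> c s = Idle}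
           = {c + workload q..<min (c + \<delta>) (c + workload q + \<beta>)}"
  using assms
proof (induction q arbitrary: c \<delta>)
  case (Cons a q)
  obtain j r where a: "a = (j, r)" by force
  with Cons.prems have wf: "wf_queue q" "0 < r" by (auto simp: wf_queue_Cons)
  show ?case
  proof (cases "\<delta> \<le> r")
    case True
    then show ?thesis using a wf workload_nonneg[OF wf(1)] by (auto simp: run_Cons)
  next
    case False
    then have "{s. c \<le> s \<and> s < c + \<delta> \<and> run (a # q) \<beta> c s = Idle}
      = {s. c + r \<le> s \<and> s < (c + r) + (\<delta> - r) \<and> run q \<beta> (c + r) s = Idle}"
      using a wf by (auto simp: run_Cons)
    also have "\<dots> = {c + r + workload q..<min (c + r + (\<delta> - r)) (c + r + workload q + \<beta>)}"
      using Cons.IH[of "\<delta> - r" "c + r"] Cons.prems(2) wf False by simp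
    finally show ?thesis using a by (simp add: algebra_simps)
  qed
qed (auto simp: run_Nil)

text \<open>Both facts go through one induction, since adding the measure of the head's interval to
  that of the rest needs measurability of the rest.\<close>

lemma emeasure_run_Busy:
  assumes "wf_queue q" "0 \<le> \<delta>"
  shows "{s. c \<le> s \<and> s < c + \<delta> \<and> run q \<beta> c s = Busy j} \<in> sets borel \<and>
         emeasure lborel {s. c \<le> s \<and> s < c + \<delta> \<and> run q \<beta> c s = Busy j}
           = ennreal (remaining q j - remaining (serve \<delta> q) j)"
  using assms
proof (induction q arbitrary: c \<delta>)
  case (Cons a q)
  obtain i r where a: "a = (i, r)" by force
  with Cons.prems have wf: "wf_queue q" "0 < r" by (auto simp: wf_queue_Cons)
  show ?case
  proof (cases "\<delta> < r")
    case True
    then have "{s. c \<le> s \<and> s < c + \<delta> \<and> run (a # q) \<beta> c s = Busy j}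
      = (if i = j then {c..<c + \<delta>} else {})"
      using a by (auto simp: run_Cons)
    then show ?thesis using a True Cons.prems by auto
  next
    case False
    let ?S = "{s. c + r \<le> s \<and> s < (c + r) + (\<delta> - r) \<and> run q \<beta> (c + r) s = Busy j}"
    let ?T = "if i = j then {c..<c + r} else {}"
    have eq: "{s. c \<le> s \<and> s < c + \<delta> \<and> run (a # q) \<beta> c s = Busy j} = ?T \<union> ?S"
      using a wf False by (auto simp: run_Cons)
    have "0 \<le> \<delta> - r" using False by simp
    note IH = conjunct1[OF Cons.IH[OF wf(1) this, of "c + r"]]
      conjunct2[OF Cons.IH[OF wf(1) this, of "c + r"]]
    have "emeasure lborel (?T \<union> ?S) = emeasure lborel ?T + emeasure lborel ?S"
      using IH(1) by (intro plus_emeasure[symmetric]) auto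
    also have "emeasure lborel ?T = ennreal (if i = j then r else 0)"
      using wf by auto
    also have "\<dots> + emeasure lborel ?S
        = ennreal ((if i = j then r else 0) + (remaining q j - remaining (serve (\<delta> - r) q) j))"
      unfolding IH(2)
      using remaining_serve_le[of q "\<delta> - r" j] wf False by (intro ennreal_plus[symmetric]) auto
    finally have "emeasure lborel (?T \<union> ?S)
        = ennreal ((if i = j then r else 0) + (remaining q j - remaining (serve (\<delta> - r) q) j))" .
    moreover have "?T \<union> ?S \<in> sets borel" using IH(1) by auto
    ultimately show ?thesis unfolding eq using a False by (simp add: add_diff_eq)
  qed
qed (auto simp: run_Nil)

lemma run_step:
  assumes "wf_queue q" "0 \<le> \<beta>"
  shows "\<exists>B. finite B \<and> (\<forall>s t. c \<le> s \<longrightarrow> s \<le> t \<longrightarrow> (\<forall>b\<in>B. b \<le> s \<or> t < b) \<longrightarrow> run q \<beta> c s = run q \<beta> c t)"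
  using assms
proof (induction q arbitrary: c)
  case Nil
  show ?case by (rule exI[of _ "{c + \<beta>}"]) (auto simp: run_Nil)
next
  case (Cons a q)
  obtain i r where a: "a = (i, r)" by force
  with Cons.prems have wf: "wf_queue q" "0 < r" by (auto simp: wf_queue_Cons)
  from Cons.IH[OF wf(1) Cons.prems(2), of "c + r"] obtain B where
    B: "finite B" "\<And>s t. c + r \<le> s \<Longrightarrow> s \<le> t \<Longrightarrow> (\<forall>b\<in>B. b \<le> s \<or> t < b) \<Longrightarrow> run q \<beta> (c + r) s = run q \<beta> (c + r) t"
    by blast
  have "run (a # q) \<beta> c s = run (a # q) \<beta> c t"
    if "s \<le> t" "\<forall>b\<in>insert (c + r) B. b \<le> s \<or> t < b" for s t
    using that a B(2)[of s t] by (cases "c + r \<le> s") (auto simp: run_Cons)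
  then show ?case using B(1) by (intro exI[of _ "insert (c + r) B"]) auto
qed


section \<open>Step functions\<close>

text \<open>Truncation allows \<open>step_fun\<close> to be asserted for the past of a schedule
  whose modes after c have not been analysed yet.\<close>

definition cut :: "real \<Rightarrow> (real \<Rightarrow> mode) \<Rightarrow> real \<Rightarrow> mode" where
  "cut c f t = (if t < c then f t else Sleep)"

lemma step_fun_iff:
  "step_fun f \<longleftrightarrow>
     (\<exists>B. finite B \<and> (\<forall>s t. s \<le> t \<longrightarrow> (\<forall>b\<in>B. b \<le> s \<or> t < b) \<longrightarrow> f s = f t))"
proof -
  have "{s<..t} \<inter> B = {} \<longleftrightarrow> (\<forall>b\<in>B. b \<le> s \<or> t < b)" for s t :: real and B
    by (auto simp: not_le not_less disjoint_iff)
  then show ?thesis unfolding step_fun_def by (simp only: imp_conjL)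
qed

lemma step_funE:
  assumes "step_fun f"
  obtains B where "finite B"
    "\<And>s t. s \<le> t \<Longrightarrow> (\<And>b. b \<in> B \<Longrightarrow> b \<le> s \<or> t < b) \<Longrightarrow> f s = f t"
proof -
  from assms obtain B where B: "finite B"
    "\<forall>s t. s \<le> t \<longrightarrow> (\<forall>b\<in>B. b \<le> s \<or> t < b) \<longrightarrow> f s = f t"
    unfolding step_fun_iff by (elim exE conjE)
  show thesis
    by (rule that[OF B(1)]) (simp add: B(2))
qed

text \<open>The function is constant on each piece \<open>C b\<close> from a jump b to the next one
  and on the piece \<open>C0\<close> before all jumps, so a preimage is a finite union of such
  pieces.\<close>

lemma step_fun_sets:
  assumes "step_fun f"
  shows "{t. P (f t)} \<in> sets borel"
proof -
  from assms obtain B where B: "finite B"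
    "\<And>s t. s \<le> t \<Longrightarrow> (\<And>b. b \<in> B \<Longrightarrow> b \<le> s \<or> t < b) \<Longrightarrow> f s = f t"
    by (rule step_funE) blast
  define C where "C b = {t. b \<le> t \<and> (\<forall>b'\<in>B. b < b' \<longrightarrow> t < b')}" for b
  define C0 where "C0 = {t. \<forall>b\<in>B. t < b}"
  have C: "C b \<in> sets borel" for b
  proof -
    have "C b = {b..} \<inter> (\<Inter>b'\<in>{b'\<in>B. b < b'}. {..<b'})"
      unfolding C_def by auto
    also have "\<dots> \<in> sets borel"
      by (cases "{b'\<in>B. b < b'} = {}") (use B(1) in \<open>auto intro!: sets.Int sets.finite_INT\<close>)
    finally show ?thesis .
  qed
  have C0: "C0 \<in> sets borel"
  proof (cases "B = {}")
    case False
    have "C0 = (\<Inter>b\<in>B. {..<b})" unfolding C0_def by auto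
    then show ?thesis using B(1) False by (auto intro!: sets.finite_INT)
  qed (simp add: C0_def)
  have C_const: "f t = f b" if "t \<in> C b" for t b
  proof -
    from that have "b \<le> t" "\<And>b'. b' \<in> B \<Longrightarrow> b' \<le> b \<or> t < b'" by (auto simp: C_def not_le)
    then show ?thesis by (rule B(2)[symmetric])
  qed
  have C0_const: "f s = f t" if "s \<in> C0" "t \<in> C0" for s t
  proof (cases "s \<le> t")
    case True
    then show ?thesis using that(2) by (intro B(2)) (auto simp: C0_def)
  next
    case False
    then show ?thesis using that(1) by (intro B(2)[symmetric]) (auto simp: C0_def)
  qed
  have cover: "t \<in> C0 \<or> (\<exists>b\<in>B. t \<in> C b)" for t
  proof (cases "{b\<in>B. b \<le> t} = {}")
    case True
    then show ?thesis by (auto simp: C0_def not_le)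
  next
    case False
    define b where "b = Max {b\<in>B. b \<le> t}"
    have "b \<in> {b\<in>B. b \<le> t}" unfolding b_def using B(1) False by (intro Max_in) auto
    moreover have "b' \<le> b" if "b' \<in> B" "b' \<le> t" for b'
      unfolding b_def using B(1) that by (intro Max_ge) auto
    ultimately show ?thesis unfolding C_def by force
  qed
  have "{t. P (f t)} = (\<Union>b\<in>{b\<in>B. P (f b)}. C b) \<union> (if \<exists>t\<in>C0. P (f t) then C0 else {})"
  proof (rule set_eqI)
    fix t
    have "P (f t) \<longleftrightarrow> (\<exists>b\<in>B. P (f b) \<and> t \<in> C b) \<or> (\<exists>s\<in>C0. P (f s)) \<and> t \<in> C0"
      using cover[of t] C_const[of t] C0_const[of t] by metis
    then show "t \<in> {t. P (f t)}
        \<longleftrightarrow> t \<in> (\<Union>b\<in>{b\<in>B. P (f b)}. C b) \<union> (if \<exists>t\<in>C0. P (f t) then C0 else {})"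
      by (simp only: mem_Collect_eq Un_iff UN_iff split: if_split) blast
  qed
  also have "\<dots> \<in> sets borel"
    using B(1) C C0 by (intro sets.Un sets.finite_UN) auto
  finally show ?thesis .
qed

lemma step_fun_right:
  assumes "step_fun f"
  shows "\<exists>e>0. \<forall>s. t \<le> s \<and> s < t + e \<longrightarrow> f s = f t"
proof -
  from assms obtain B where B: "finite B"
    "\<And>s t. s \<le> t \<Longrightarrow> (\<And>b. b \<in> B \<Longrightarrow> b \<le> s \<or> t < b) \<Longrightarrow> f s = f t"
    by (rule step_funE) blast
  have "finite (B - {t})" using B(1) by simp
  from finite_set_avoid[OF this, of t] obtain e where e: "e > 0" "\<forall>x\<in>B - {t}. x \<noteq> t \<longrightarrow> e \<le> dist t x"
    by blast
  have "f s = f t" if "t \<le> s" "s < t + e" for s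
  proof (rule B(2)[symmetric])
    fix b assume "b \<in> B"
    then have "b = t \<or> e \<le> dist t b" using e(2) by blast
    then show "b \<le> t \<or> s < b" using that by (auto simp: dist_real_def abs_if split: if_splits)
  qed (use that in simp)
  then show ?thesis using e(1) by blast
qed

lemma step_fun_left:
  assumes "step_fun f"
  shows "\<exists>e>0. \<forall>s s'. t - e < s \<and> s < t \<and> t - e < s' \<and> s' < t \<longrightarrow> f s = f s'"
proof -
  from assms obtain B where B: "finite B"
    "\<And>s t. s \<le> t \<Longrightarrow> (\<And>b. b \<in> B \<Longrightarrow> b \<le> s \<or> t < b) \<Longrightarrow> f s = f t"
    by (rule step_funE) blast
  have "finite (B - {t})" using B(1) by simp
  from finite_set_avoid[OF this, of t] obtain e where e: "e > 0" "\<forall>x\<in>B - {t}. x \<noteq> t \<longrightarrow> e \<le> dist t x"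
    by blast
  have *: "f s = f s'" if "t - e < s" "s \<le> s'" "s' < t" for s s'
  proof (rule B(2))
    fix b assume "b \<in> B"
    then have "b = t \<or> e \<le> dist t b" using e(2) by blast
    then show "b \<le> s \<or> s' < b" using that by (auto simp: dist_real_def abs_if split: if_splits)
  qed (use that in simp)
  have "f s = f s'" if "t - e < s" "s < t" "t - e < s'" "s' < t" for s s'
    using *[of s s'] *[of s' s] that linear[of s s'] by argo
  then show ?thesis using e(1) by blast
qed

text \<open>A turn-on is always a jump. This matters because \<open>machine_energy\<close> counts
  turn-ons with \<open>card\<close>, which is 0 on infinite sets.\<close>

lemma finite_turn_ons:
  assumes "step_fun f"
  shows "finite (turn_ons f)"
proof -
  from assms obtain B where B: "finite B"
    "\<And>s t. s \<le> t \<Longrightarrow> (\<And>b. b \<in> B \<Longrightarrow> b \<le> s \<or> t < b) \<Longrightarrow> f s = f t"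
    by (rule step_funE) blast
  have "t \<in> B" if "t \<in> turn_ons f" for t
  proof (rule ccontr)
    assume "t \<notin> B"
    from finite_set_avoid[OF B(1), of t] obtain e where e: "e > 0" "\<forall>x\<in>B. x \<noteq> t \<longrightarrow> e \<le> dist t x"
      by blast
    from that obtain d where d: "f t \<noteq> Sleep" "d < t" "\<And>s. d < s \<Longrightarrow> s < t \<Longrightarrow> f s = Sleep"
      unfolding turn_ons_def by (auto simp: eventually_at_left_field)
    define s where "s = (max d (t - e) + t) / 2"
    have s: "d < s" "t - e < s" "s < t" using d e by (auto simp: s_def)
    have "f s = f t"
    proof (rule B(2))
      fix b assume "b \<in> B"
      then have "b \<noteq> t" "e \<le> dist t b" using e(2) \<open>t \<notin> B\<close> by auto
      then show "b \<le> s \<or> t < b" using s by (auto simp: dist_real_def abs_if split: if_splits)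
    qed (use s in simp)
    then show False using d(1) d(3)[OF s(1,3)] by simp
  qed
  then show ?thesis using finite_subset[OF subsetI B(1)] by simp
qed

text \<open>The witness is the supremum y of the sleeping times in [t, x]: right-continuity excludes
  that the machine sleeps at y, and constancy just before y carries a nearby sleeping time over to a
  whole left neighbourhood.\<close>

lemma turn_on_between:
  assumes "step_fun f" "t < x" "f t = Sleep" "f x \<noteq> Sleep"
  shows "\<exists>y\<in>turn_ons f. t < y \<and> y \<le> x"
proof -
  define S where "S = {s\<in>{t..x}. f s = Sleep}"
  define y where "y = Sup S"
  have bdd: "bdd_above S" unfolding S_def by (rule bdd_aboveI[of _ x]) auto
  have "t \<in> S" using assms by (auto simp: S_def)
  have y: "t \<le> y" "y \<le> x"
    unfolding y_def using \<open>t \<in> S\<close> bdd cSup_upper[OF \<open>t \<in> S\<close> bdd]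
    by (auto simp: S_def intro!: cSup_least)
  have above: "f s \<noteq> Sleep" if "y < s" "s \<le> x" for s
    using that y cSup_upper[OF _ bdd, of s] by (force simp: y_def S_def)
  have "f y \<noteq> Sleep"
  proof
    assume "f y = Sleep"
    then have "y < x" using assms y by (cases "y = x") auto
    obtain e where e: "e > 0" "\<And>s. y \<le> s \<Longrightarrow> s < y + e \<Longrightarrow> f s = f y"
      using step_fun_right[OF assms(1), of y] by blast
    define s where "s = min x (y + e / 2)"
    have "y < s" "s \<le> x" "s < y + e" using e \<open>y < x\<close> by (auto simp: s_def)
    then show False using above[of s] e(2)[of s] \<open>f y = Sleep\<close> by auto
  qed
  obtain e where e: "e > 0" "\<And>s s'. y - e < s \<Longrightarrow> s < y \<Longrightarrow> y - e < s' \<Longrightarrow> s' < y \<Longrightarrow> f s = f s'"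
    using step_fun_left[OF assms(1), of y] by blast
  obtain s where s: "s \<in> S" "y - e < s"
    using e(1) less_cSup_iff[OF _ bdd, of "y - e"] \<open>t \<in> S\<close> unfolding y_def by auto
  have "s \<le> y" unfolding y_def using s bdd by (intro cSup_upper)
  with s \<open>f y \<noteq> Sleep\<close> have "s < y" "f s = Sleep" by (auto simp: S_def order.order_iff_strict)
  then have "\<forall>\<^sub>F s' in at_left y. f s' = Sleep"
    unfolding eventually_at_left_field using e(1) e(2)[OF _ _ s(2)]
    by (intro exI[of _ "y - e"]) auto
  moreover have "t < y" using \<open>s < y\<close> s by (auto simp: S_def)
  ultimately show ?thesis using \<open>f y \<noteq> Sleep\<close> y by (auto simp: turn_ons_def)
qed

section \<open>A lower bound for single-machine schedules\<close>

definition due :: "job set \<Rightarrow> real \<Rightarrow> real" where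
  "due U x = (\<Sum>j\<in>{j \<in> U. dl j \<le> x}. proc j)"

text \<open>
  An entry \<open>(U, \<tau>, \<kappa>)\<close> of a log, whose newest entry comes first, describes a phase of the
  algorithm, i.e. a maximal period in which some machine is on: \<open>U\<close> are the jobs that arrive
  after the previous phase, \<open>\<tau>\<close> is the start of the phase, and its turn-ons and idle times cost
  at most \<open>3 + \<kappa>\<close>.
\<close>

fun separated :: "real \<Rightarrow> job set \<Rightarrow> (job set \<times> real \<times> real) list \<Rightarrow> bool" where
  "separated \<psi> U [] \<longleftrightarrow> True"
| "separated \<psi> U ((U', \<tau>', \<kappa>') # _) \<longleftrightarrow>
     U \<subseteq> U' \<and> (\<forall>j\<in>U. 3 + \<kappa>' \<le> 2 * \<psi> * (arr j - \<tau>' - (if \<kappa>' = 0 then 1/2 else 0)))"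

text \<open>The demand conditions are certificates against every single-machine schedule: the first
  forces \<open>first U \<le> \<tau> + 1/2\<close>, the second forces
  \<open>first U \<le> \<tau>\<close> and supplies the processing that pays for \<kappa>.\<close>

fun valid_log :: "real \<Rightarrow> job set \<Rightarrow> (job set \<times> real \<times> real) list \<Rightarrow> bool" where
  "valid_log \<psi> J [] \<longleftrightarrow> True"
| "valid_log \<psi> J ((U, \<tau>, \<kappa>) # ps) \<longleftrightarrow>
     U \<subseteq> J \<and>
     (\<exists>x. 0 < due U x \<and> x - (\<tau> + 1/2) \<le> due U x) \<and>
     (\<kappa> = 0 \<or> 0 < \<kappa> \<and> (\<exists>x. x - \<tau> \<le> due U x \<and> \<kappa> / 2 \<le> x - \<tau>)) \<and>
     separated \<psi> U ps \<and>
     valid_log \<psi> J ps"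

definition log_cost :: "(job set \<times> real \<times> real) list \<Rightarrow> real" where
  "log_cost ps = (\<Sum>(U, \<tau>, \<kappa>)\<leftarrow>ps. 3 + \<kappa>)"

lemma log_cost_simps [simp]:
  "log_cost [] = 0" "log_cost ((U, \<tau>, \<kappa>) # ps) = 3 + \<kappa> + log_cost ps"
  by (simp_all add: log_cost_def)

lemma due_mono:
  assumes "finite U'" "U \<subseteq> U'" "\<forall>j\<in>U'. 0 < proc j"
  shows "due U x \<le> due U' x"
  unfolding due_def using assms by (intro sum_mono2) (auto intro: less_imp_le)

lemma due_nonneg: "\<forall>j\<in>U. 0 < proc j \<Longrightarrow> 0 \<le> due U x"
  unfolding due_def by (intro sum_nonneg) (auto intro: less_imp_le)

text \<open>Finite idle time can be assumed because a schedule that idles forever has infinite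
  energy; \<open>opt_energy_ge\<close> treats that case apart.\<close>

locale single_schedule =
  fixes \<psi> :: real and J :: "job set" and g :: "real \<Rightarrow> mode"
  assumes psi: "0 < \<psi>" "\<psi> \<le> 1"
    and fin: "finite J"
    and pos: "\<And>j. j \<in> J \<Longrightarrow> 0 < proc j"
    and step: "step_fun g"
    and busyD: "\<And>t j. g t = Busy j \<Longrightarrow> j \<in> J \<and> t \<in> {arr j..dl j}"
    and complete: "\<And>j. j \<in> J \<Longrightarrow> emeasure lborel {t. g t = Busy j} = ennreal (proc j)"
    and fin_idle: "emeasure lborel {t. g t = Idle} < \<infinity>"
begin

definition busy :: "real set" where
  "busy = {t. \<exists>j. g t = Busy j}"

definition idle :: "real set" where
  "idle = {t. g t = Idle}"

text \<open>
  This is the energy used before time \<open>x\<close>, three times, except that one of the three units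
  paid for each unit of processing is left to pay for the processing by the algorithm.
\<close>

definition weight :: "real \<Rightarrow> real" where
  "weight x = 3 * card (turn_ons g \<inter> {..x}) + 2 * measure lborel (busy \<inter> {..<x})
              + 3 * \<psi> * measure lborel (idle \<inter> {..<x})"

definition first :: "job set \<Rightarrow> real" where
  "first U = Inf {t. \<exists>j\<in>U. g t = Busy j}"

lemma sets_mode [measurable]: "{t. g t = v} \<in> sets borel"
  using step_fun_sets[OF step, of "\<lambda>w. w = v"] .

lemma busy_eq: "busy = (\<Union>j\<in>J. {t. g t = Busy j})"
  using busyD by (auto simp: busy_def)

lemma busy_sets [measurable]: "busy \<in> sets borel"
  unfolding busy_eq using fin by auto

lemma idle_sets [measurable]: "idle \<in> sets borel"
  unfolding idle_def by auto

lemma emeasure_jobs: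
  assumes "D \<subseteq> J"
  shows "emeasure lborel (\<Union>j\<in>D. {t. g t = Busy j}) = ennreal (\<Sum>j\<in>D. proc j)"
proof -
  have "finite D" using assms fin finite_subset by blast
  then have "emeasure lborel (\<Union>j\<in>D. {t. g t = Busy j}) = (\<Sum>j\<in>D. emeasure lborel {t. g t = Busy j})"
    by (intro sum_emeasure[symmetric]) (auto simp: disjoint_family_on_def)
  also have "\<dots> = (\<Sum>j\<in>D. ennreal (proc j))"
    using assms complete by (intro sum.cong) auto
  also have "\<dots> = ennreal (\<Sum>j\<in>D. proc j)"
    using assms pos by (intro sum_ennreal) (auto intro: less_imp_le)
  finally show ?thesis .
qed

lemma emeasure_busy: "emeasure lborel busy = ennreal (\<Sum>j\<in>J. proc j)"
  unfolding busy_eq by (rule emeasure_jobs) simp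

lemma busy_fm: "busy \<in> fmeasurable lborel"
  by (intro fmeasurableI) (auto simp: emeasure_busy)

lemma idle_fm: "idle \<in> fmeasurable lborel"
  using fin_idle by (intro fmeasurableI) (auto simp: idle_def)

lemma busy_Int_fm: "A \<in> sets borel \<Longrightarrow> busy \<inter> A \<in> fmeasurable lborel"
  using busy_fm by (intro fmeasurable_Int_fmeasurable) auto

lemma idle_Int_fm: "A \<in> sets borel \<Longrightarrow> idle \<inter> A \<in> fmeasurable lborel"
  using idle_fm by (intro fmeasurable_Int_fmeasurable) auto

lemma measure_Un_fm:
  assumes "A \<in> fmeasurable lborel" "B \<in> fmeasurable lborel" "A \<inter> B = {}"
  shows "measure lborel (A \<union> B) = measure lborel A + measure lborel B"
  using assms by (intro measure_Union) (auto simp: fmeasurable_def)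

text \<open>The infimum is attained because modes do not change immediately to the right of a point.
  It exists because jobs have positive processing time and are not executed before the earliest
  arrival.\<close>

lemma first:
  assumes "U \<subseteq> J" "U \<noteq> {}"
  shows "\<exists>j\<in>U. g (first U) = Busy j"
    and "\<And>t j. j \<in> U \<Longrightarrow> g t = Busy j \<Longrightarrow> first U \<le> t"
proof -
  let ?S = "{t. \<exists>j\<in>U. g t = Busy j}"
  obtain i where i: "i \<in> U" "i \<in> J" using assms by auto
  then have "emeasure lborel {t. g t = Busy i} \<noteq> 0" using complete pos[of i] by auto
  then have "{t. g t = Busy i} \<noteq> {}" by (metis emeasure_empty)
  then have ne: "?S \<noteq> {}" using i by auto
  have bdd: "bdd_below ?S"
  proof (rule bdd_belowI)
    fix t assume "t \<in> ?S"
    then obtain j where j: "j \<in> J" "arr j \<le> t" using busyD by auto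
    have "Min (arr ` J) \<le> arr j" using j fin by simp
    then show "Min (arr ` J) \<le> t" using j by simp
  qed
  show "\<And>t j. j \<in> U \<Longrightarrow> g t = Busy j \<Longrightarrow> first U \<le> t"
    unfolding first_def using bdd by (intro cInf_lower) auto
  obtain e where e: "e > 0" "\<And>s. first U \<le> s \<Longrightarrow> s < first U + e \<Longrightarrow> g s = g (first U)"
    using step_fun_right[OF step, of "first U"] by blast
  obtain s where s: "s \<in> ?S" "s < first U + e"
    using cInf_less_iff[OF ne bdd, of "first U + e"] e(1) unfolding first_def by auto
  have "first U \<le> s" unfolding first_def using s bdd by (intro cInf_lower)
  then have "g s = g (first U)" using e(2) s(2) by blast
  then show "\<exists>j\<in>U. g (first U) = Busy j" using s(1) by auto
qed

text \<open>What is due by \<open>x\<close> but not done before \<open>y\<close> must be done in \<open>[y, x]\<close>.\<close>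

lemma due_le:
  assumes "U \<subseteq> J" "U \<noteq> {}"
  shows "due U x \<le> measure lborel (busy \<inter> {first U..<y}) + max 0 (x - y)"
proof -
  let ?D = "{j \<in> U. dl j \<le> x}"
  let ?A = "\<Union>j\<in>?D. {t. g t = Busy j}"
  let ?B = "busy \<inter> {first U..<y}"
  have D: "?D \<subseteq> J" using assms by auto
  have "ennreal (due U x) = emeasure lborel ?A"
    using emeasure_jobs[OF D] by (simp add: due_def)
  also have "\<dots> \<le> emeasure lborel (?B \<union> {y..x})"
  proof (rule emeasure_mono)
    show "?A \<subseteq> ?B \<union> {y..x}"
    proof
      fix t assume "t \<in> ?A"
      then obtain j where j: "j \<in> U" "dl j \<le> x" "g t = Busy j" by auto
      then have "first U \<le> t" using first(2)[OF assms] by auto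
      moreover have "t \<le> x" using busyD[OF j(3)] j by auto
      ultimately show "t \<in> ?B \<union> {y..x}" using j by (auto simp: busy_def)
    qed
  qed auto
  also have "\<dots> \<le> emeasure lborel ?B + emeasure lborel {y..x}"
    by (intro emeasure_subadditive) auto
  also have "emeasure lborel ?B = ennreal (measure lborel ?B)"
    using busy_Int_fm by (intro emeasure_eq_measure2) auto
  also have "emeasure lborel {y..x} = ennreal (max 0 (x - y))"
    by (cases "y \<le> x") auto
  also have "ennreal (measure lborel ?B) + ennreal (max 0 (x - y))
    = ennreal (measure lborel ?B + max 0 (x - y))"
    by (intro ennreal_plus[symmetric]) auto
  finally show ?thesis by (subst (asm) ennreal_le_iff) auto
qed

text \<open>This is \<open>due_le\<close> at \<open>y = first U\<close>, where nothing is done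
  beforehand: all the work due by x has to fit between \<open>first U\<close> and x.\<close>

lemma first_le:
  assumes "U \<subseteq> J" "0 < due U x" "x - y \<le> due U x"
  shows "first U \<le> y"
proof -
  have "U \<noteq> {}" using assms(2) by (auto simp: due_def)
  from due_le[OF assms(1) this, of x "first U"] show ?thesis using assms by auto
qed

lemma weight_diff:
  assumes "x \<le> y"
  shows "weight y = weight x + 3 * card (turn_ons g \<inter> {x<..y})
           + 2 * measure lborel (busy \<inter> {x..<y}) + 3 * \<psi> * measure lborel (idle \<inter> {x..<y})"
proof -
  have split: "A \<inter> {..<y} = (A \<inter> {..<x}) \<union> (A \<inter> {x..<y})" for A :: "real set"
    using assms by auto
  have b: "measure lborel (busy \<inter> {..<y}) = measure lborel (busy \<inter> {..<x}) + measure lborel (busy \<inter> {x..<y})"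
    unfolding split[of busy] using busy_Int_fm by (intro measure_Un_fm) auto
  have i: "measure lborel (idle \<inter> {..<y}) = measure lborel (idle \<inter> {..<x}) + measure lborel (idle \<inter> {x..<y})"
    unfolding split[of idle] using idle_Int_fm by (intro measure_Un_fm) auto
  have "turn_ons g \<inter> {..y} = (turn_ons g \<inter> {..x}) \<union> (turn_ons g \<inter> {x<..y})" using assms by auto
  then have "card (turn_ons g \<inter> {..y}) = card (turn_ons g \<inter> {..x}) + card (turn_ons g \<inter> {x<..y})"
    using finite_turn_ons[OF step] by (simp add: card_Un_disjoint disjoint_iff)
  then show ?thesis unfolding weight_def b i by (simp add: algebra_simps)
qed

lemma weight_turn_on:
  assumes "t < y" "x \<le> t" "g t = Sleep" "g y \<noteq> Sleep"
  shows "1 \<le> card (turn_ons g \<inter> {x<..y})"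
proof -
  obtain z where "z \<in> turn_ons g" "t < z" "z \<le> y"
    using turn_on_between[OF step assms(1,3,4)] by blast
  then have "z \<in> turn_ons g \<inter> {x<..y}" using assms by auto
  then show ?thesis
    using finite_turn_ons[OF step] by (metis One_nat_def Suc_leI card_gt_0_iff empty_iff finite_Int)
qed

text \<open>A machine that never slept before \<open>first U\<close> would have idled on a whole
  half-line before the first arrival, against finite idle time. So it was turned on, possibly at
  \<open>first U\<close> itself, which is why \<open>weight\<close> includes the right end point for
  turn-ons.\<close>

lemma weight_first_ge:
  assumes "U \<subseteq> J" "U \<noteq> {}"
  shows "3 \<le> weight (first U)"
proof -
  have g: "g (first U) \<noteq> Sleep" using first(1)[OF assms] by auto
  have "\<exists>t<first U. g t = Sleep"
  proof (rule ccontr)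
    assume no: "\<not> ?thesis"
    define a where "a = min (first U) (Min (arr ` J))"
    have "{..<a} \<subseteq> {t. g t = Idle}"
    proof
      fix t assume t: "t \<in> {..<a}"
      have "g t \<noteq> Busy j" for j
      proof
        assume "g t = Busy j"
        with busyD have "j \<in> J" "arr j \<le> t" by auto
        moreover have "Min (arr ` J) \<le> arr j" using \<open>j \<in> J\<close> fin by simp
        ultimately show False using t by (auto simp: a_def)
      qed
      then show "t \<in> {t. g t = Idle}" using no t by (cases "g t") (auto simp: a_def)
    qed
    then have "emeasure lborel {..<a} \<le> emeasure lborel {t. g t = Idle}"
      by (intro emeasure_mono) auto
    moreover have "emeasure lborel {..<a} = \<infinity>"
    proof (rule ccontr)
      assume "emeasure lborel {..<a} \<noteq> \<infinity>"
      then obtain r where r: "0 \<le> r" "emeasure lborel {..<a} = ennreal r"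
        by (cases "emeasure lborel {..<a}") auto
      have "emeasure lborel {a - r - 1..<a} \<le> emeasure lborel {..<a}"
        by (intro emeasure_mono) auto
      then show False using r by (simp add: ennreal_le_iff)
    qed
    ultimately show False using fin_idle by (simp add: top_unique)
  qed
  then obtain t where t: "t < first U" "g t = Sleep" by blast
  obtain z where z: "z \<in> turn_ons g" "t < z" "z \<le> first U"
    using turn_on_between[OF step t g] by blast
  then have "z \<in> turn_ons g \<inter> {..first U}" by auto
  then have "1 \<le> card (turn_ons g \<inter> {..first U})"
    using finite_turn_ons[OF step] by (metis One_nat_def Suc_leI card_gt_0_iff empty_iff finite_Int)
  then show ?thesis unfolding weight_def using psi by (simp add: add_increasing2)
qed

text \<open>The stretch from \<open>first U'\<close> to \<open>first U\<close> starts by \<tau>, or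
  by \<tau> + 1/2 if \<kappa> = 0, and ends no earlier than some arrival in U, so
  \<open>separated\<close> bounds its length from below. What pays depends on whether the schedule
  sleeps within it.\<close>

lemma weight_phase:
  assumes U: "U \<subseteq> U'" "U \<noteq> {}" and U': "U' \<subseteq> J"
    and a: "0 < due U' x" "x - (\<tau> + 1/2) \<le> due U' x"
    and b: "\<kappa> = 0 \<or> 0 < \<kappa> \<and> (\<exists>x. x - \<tau> \<le> due U' x \<and> \<kappa> / 2 \<le> x - \<tau>)"
    and c: "\<forall>j\<in>U. 3 + \<kappa> \<le> 2 * \<psi> * (arr j - \<tau> - (if \<kappa> = 0 then 1/2 else 0))"
  shows "weight (first U') + 3 + \<kappa> \<le> weight (first U)"
proof -
  let ?x = "first U'" and ?y = "first U"
  have ne: "U' \<noteq> {}" and UJ: "U \<subseteq> J" using U U' by auto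
  obtain j where j: "j \<in> U" "g ?y = Busy j" using first(1)[OF UJ U(2)] by blast
  have arr: "arr j \<le> ?y" using busyD[OF j(2)] by auto
  define d where "d = (if \<kappa> = 0 then 1/2 else 0 :: real)"
  have "?x \<le> \<tau> + d"
  proof (cases "\<kappa> = 0")
    case True
    then show ?thesis using first_le[OF U' a] by (simp add: d_def)
  next
    case False
    then obtain z where "z - \<tau> \<le> due U' z" "\<kappa> / 2 \<le> z - \<tau>" "0 < \<kappa>" using b by blast
    then show ?thesis using first_le[OF U', of z \<tau>] False by (simp add: d_def)
  qed
  have "3 + \<kappa> \<le> 2 * \<psi> * (arr j - \<tau> - d)" using c j by (auto simp: d_def)
  also have "\<dots> \<le> 2 * \<psi> * (?y - ?x)"
    using \<open>?x \<le> \<tau> + d\<close> arr psi by (intro mult_left_mono) auto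
  finally have len: "3 + \<kappa> \<le> 2 * \<psi> * (?y - ?x)" .
  have k0: "0 \<le> \<kappa>" using b by auto
  have "0 < 2 * \<psi> * (?y - ?x)" using len k0 by linarith
  then have xy: "?x < ?y" using psi by (simp add: zero_less_mult_iff)
  show ?thesis
  proof (cases "\<exists>t. ?x \<le> t \<and> t < ?y \<and> g t = Sleep")
    case True
    then obtain t where t: "?x \<le> t" "t < ?y" "g t = Sleep" by blast
    have "1 \<le> card (turn_ons g \<inter> {?x<..?y})"
      using weight_turn_on[OF t(2,1,3)] j by auto
    \<comment> \<open>At least \<open>z - \<tau>\<close> units are due by z, and at most
      \<open>z - ?y\<close> of them fit after \<open>?y\<close>. So at least the smaller of
      \<open>z - \<tau>\<close> and \<open>?y - \<tau>\<close> is processed before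
      \<open>?y\<close>; the latter is at least \<kappa> / 2 by separation and \<psi> \<le>
      1.\<close>
    moreover have "\<kappa> / 2 \<le> measure lborel (busy \<inter> {?x..<?y})"
    proof (cases "\<kappa> = 0")
      case False
      then obtain z where z: "z - \<tau> \<le> due U' z" "\<kappa> / 2 \<le> z - \<tau>" "0 < \<kappa>" using b by blast
      have "3 + \<kappa> \<le> 2 * \<psi> * (?y - \<tau>)"
        using \<open>3 + \<kappa> \<le> 2 * \<psi> * (arr j - \<tau> - d)\<close> arr psi False
        by (smt (verit) d_def mult_left_mono)
      moreover have "0 < ?y - \<tau>"
      proof -
        have "0 < 2 * \<psi> * (?y - \<tau>)" using calculation k0 by linarith
        then show ?thesis using psi by (simp add: zero_less_mult_iff)
      qed
      moreover have "2 * \<psi> * (?y - \<tau>) \<le> 2 * (?y - \<tau>)"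
        using psi calculation(2) by (intro mult_right_mono) auto
      ultimately have "3 + \<kappa> \<le> 2 * (?y - \<tau>)" by (rule_tac order_trans)
      then have "\<kappa> / 2 \<le> ?y - \<tau>" by simp
      then show ?thesis using due_le[OF U' ne, of z ?y] z by (auto simp: max_def split: if_splits)
    qed simp
    ultimately show ?thesis
      unfolding weight_diff[OF less_imp_le[OF xy]] using psi by (simp add: add_increasing2)
  next
    case False
    then have "{?x..<?y} = (busy \<inter> {?x..<?y}) \<union> (idle \<inter> {?x..<?y})"
      by (auto simp: busy_def idle_def) (metis mode.exhaust)
    moreover have "measure lborel ((busy \<inter> {?x..<?y}) \<union> (idle \<inter> {?x..<?y}))
       = measure lborel (busy \<inter> {?x..<?y}) + measure lborel (idle \<inter> {?x..<?y})"
      using busy_Int_fm idle_Int_fm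
      by (intro measure_Un_fm) (auto simp: busy_def idle_def)
    ultimately have sum: "?y - ?x = measure lborel (busy \<inter> {?x..<?y}) + measure lborel (idle \<inter> {?x..<?y})"
      using xy by (metis less_imp_le measure_lborel_Ico)
    \<comment> \<open>A busy unit of time weighs 2 \<ge> 2 * \<psi> and an idle one 3 * \<psi>, so
      the length alone suffices.\<close>
    have "\<psi> * measure lborel (busy \<inter> {?x..<?y}) \<le> 1 * measure lborel (busy \<inter> {?x..<?y})"
      using psi by (intro mult_right_mono) auto
    moreover have "0 \<le> \<psi> * measure lborel (idle \<inter> {?x..<?y})" using psi by simp
    ultimately show ?thesis
      unfolding weight_diff[OF less_imp_le[OF xy]] using len unfolding sum by (simp add: algebra_simps)
  qed
qed

text \<open>The stretches of successive phases are disjoint, so their charges add up; the 3 is the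
  first turn-on, which no older phase has used.\<close>

lemma weight_first_log:
  "valid_log \<psi> J ((U, \<tau>, \<kappa>) # ps) \<Longrightarrow> 3 + log_cost ps \<le> weight (first U)"
proof (induction ps arbitrary: U \<tau> \<kappa>)
  case Nil
  then have "U \<noteq> {}" by (auto simp: due_def)
  then show ?case using Nil weight_first_ge[of U] by simp
next
  case (Cons p ps)
  obtain U' \<tau>' \<kappa>' where p: "p = (U', \<tau>', \<kappa>')" by (cases p) auto
  have "U \<noteq> {}" using Cons.prems by (auto simp: due_def)
  have "weight (first U') + 3 + \<kappa>' \<le> weight (first U)"
  proof -
    obtain x where "0 < due U' x" "x - (\<tau>' + 1/2) \<le> due U' x" using Cons.prems p by auto
    then show ?thesis
      using Cons.prems p \<open>U \<noteq> {}\<close> by (intro weight_phase[where \<tau> = \<tau>' and x = x]) auto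
  qed
  moreover have "3 + log_cost ps \<le> weight (first U')"
    using Cons.prems p by (intro Cons.IH[of U' \<tau>' \<kappa>']) simp
  ultimately show ?case using p by simp
qed

text \<open>The newest phase has no successor that ends its stretch. The first turn-on pays its 3,
  and the processing after \<open>first U\<close> pays its \<kappa>.\<close>

lemma log_cost_le:
  assumes "valid_log \<psi> J ps"
  shows "log_cost ps \<le> 3 * card (turn_ons g) + 2 * (\<Sum>j\<in>J. proc j) + 3 * \<psi> * measure lborel idle"
proof (cases ps)
  case Nil
  moreover have "0 \<le> (\<Sum>j\<in>J. proc j)" using pos by (intro sum_nonneg) (auto intro: less_imp_le)
  ultimately show ?thesis using psi by simp
next
  case (Cons p ps')
  obtain U \<tau> \<kappa> where p: "p = (U, \<tau>, \<kappa>)" by (cases p) auto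
  have U: "U \<subseteq> J" "U \<noteq> {}" using assms Cons p by (auto simp: due_def)
  obtain y where y: "first U \<le> y" "\<kappa> / 2 \<le> measure lborel (busy \<inter> {first U..<y})"
  proof (cases "\<kappa> = 0")
    case True
    then show ?thesis using that[of "first U"] by simp
  next
    case False
    then obtain z where z: "z - \<tau> \<le> due U z" "\<kappa> / 2 \<le> z - \<tau>" using assms Cons p by auto
    \<comment> \<open>At this end point no time is left until z, so \<open>due_le\<close> places all
      the work due by z before it.\<close>
    then show ?thesis
      using that[of "max z (first U)"] due_le[OF U, of z "max z (first U)"] by auto
  qed
  have "log_cost ps \<le> weight (first U) + \<kappa>"
    using weight_first_log[of U \<tau> \<kappa> ps'] assms Cons p by simp
  also have "\<dots> \<le> weight y"
    unfolding weight_diff[OF y(1)] using y(2) psi by (simp add: add_increasing2 add_increasing)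
  also have "\<dots> \<le> 3 * card (turn_ons g) + 2 * measure lborel busy + 3 * \<psi> * measure lborel idle"
  proof -
    have "card (turn_ons g \<inter> {..y}) \<le> card (turn_ons g)"
      using finite_turn_ons[OF step] by (intro card_mono) auto
    moreover have "measure lborel (busy \<inter> {..<y}) \<le> measure lborel busy"
      using busy_fm by (intro measure_mono_fmeasurable) auto
    moreover have "measure lborel (idle \<inter> {..<y}) \<le> measure lborel idle"
      using idle_fm by (intro measure_mono_fmeasurable) auto
    ultimately show ?thesis
      unfolding weight_def using psi by (intro add_mono mult_left_mono) auto
  qed
  also have "measure lborel busy = (\<Sum>j\<in>J. proc j)"
    using emeasure_busy pos by (simp add: measure_def sum_nonneg less_imp_le)
  finally show ?thesis .
qed

lemma machine_energy_eq:
  "machine_energy \<psi> g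
     = ennreal (card (turn_ons g) + (\<Sum>j\<in>J. proc j) + \<psi> * measure lborel idle)"
proof -
  have "emeasure lborel idle = ennreal (measure lborel idle)"
    using idle_fm by (intro emeasure_eq_measure2) auto
  then have "machine_energy \<psi> g = ennreal (card (turn_ons g)) + ennreal (\<Sum>j\<in>J. proc j)
       + ennreal \<psi> * ennreal (measure lborel idle)"
    unfolding machine_energy_def using emeasure_busy
    by (simp add: busy_def idle_def ennreal_of_nat_eq_real_of_nat)
  also have "\<dots> = ennreal (card (turn_ons g) + (\<Sum>j\<in>J. proc j) + \<psi> * measure lborel idle)"
    using psi pos by (simp add: ennreal_mult[symmetric] ennreal_plus[symmetric] sum_nonneg less_imp_le
        del: ennreal_plus)
  finally show ?thesis .
qed

end

text \<open>\<open>log_cost_le\<close> uses two of the three units for each unit of processing; the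
  third one becomes the sum of processing times on the left.\<close>

lemma opt_energy_ge:
  assumes "0 < \<psi>" "\<psi> \<le> 1" "finite J" "\<And>j. j \<in> J \<Longrightarrow> 0 < proc j" "valid_log \<psi> J ps"
  shows "ennreal ((\<Sum>j\<in>J. proc j) + log_cost ps) \<le> 3 * opt_energy \<psi> J"
proof -
  have *: "ennreal ((\<Sum>j\<in>J. proc j) + log_cost ps) / 3 \<le> energy \<psi> \<sigma>"
    if "feasible J \<sigma>" for \<sigma> :: "unit schedule"
  proof (cases "emeasure lborel {t. \<sigma> () t = Idle} < \<infinity>")
    case True
    interpret single_schedule \<psi> J "\<sigma> ()"
      using assms that True by unfold_locales (auto simp: feasible_def)
    have "(\<Sum>j\<in>J. proc j) + log_cost ps
       \<le> 3 * (card (turn_ons (\<sigma> ())) + (\<Sum>j\<in>J. proc j) + \<psi> * measure lborel idle)"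
      using log_cost_le[OF assms(5)] by simp
    then have "ennreal ((\<Sum>j\<in>J. proc j) + log_cost ps)
      \<le> ennreal (3 * (card (turn_ons (\<sigma> ())) + (\<Sum>j\<in>J. proc j) + \<psi> * measure lborel idle))"
      by (rule ennreal_leI)
    also have "\<dots> = energy \<psi> \<sigma> * 3"
      unfolding energy_def UNIV_unit using machine_energy_eq
      by (subst ennreal_mult') (auto simp: mult.commute)
    finally show ?thesis by (subst divide_le_posI_ennreal) (auto simp: mult.commute)
  next
    case False
    then have "energy \<psi> \<sigma> = \<infinity>"
      using assms(1)
      by (simp add: energy_def machine_energy_def UNIV_unit less_top[symmetric] ennreal_mult_top)
    then show ?thesis by simp
  qed
  have "ennreal ((\<Sum>j\<in>J. proc j) + log_cost ps) / 3 \<le> opt_energy \<psi> J"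
    unfolding opt_energy_def using * by (intro INF_greatest) auto
  then have "3 * (ennreal ((\<Sum>j\<in>J. proc j) + log_cost ps) / 3) \<le> 3 * opt_energy \<psi> J"
    by (intro mult_left_mono) auto
  then show ?thesis
    by (subst (asm) ennreal_times_divide, subst (asm) mult.commute)
      (simp add: ennreal_mult_divide_eq)
qed

section \<open>The history of a machine\<close>

text \<open>
  \<open>D\<close> contains the turn-on times so far, including a turn-on at time \<open>c\<close> itself, and \<open>I\<close> is the
  total idle time before \<open>c\<close>.
\<close>

definition history :: "real \<Rightarrow> bool \<Rightarrow> (real \<Rightarrow> mode) \<Rightarrow> real set \<Rightarrow> real \<Rightarrow> bool" where
  "history c is_on h D I \<longleftrightarrow>
     step_fun (cut c h) \<and> finite D \<and> turn_ons h \<inter> {..<c} \<subseteq> D \<and>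
     (is_on \<longrightarrow> c \<in> D \<or> \<not> (\<forall>\<^sub>F s in at_left c. h s = Sleep)) \<and>
     0 \<le> I \<and> emeasure lborel {t. t < c \<and> h t = Idle} = ennreal I"

lemma not_eventually_Sleep:
  fixes c t :: real
  assumes "c < t" "\<And>s. c \<le> s \<Longrightarrow> s < t \<Longrightarrow> h s \<noteq> Sleep"
  shows "\<not> (\<forall>\<^sub>F s in at_left t. h s = Sleep)"
proof
  assume "\<forall>\<^sub>F s in at_left t. h s = Sleep"
  then obtain d where d: "d < t" "\<And>s. d < s \<Longrightarrow> s < t \<Longrightarrow> h s = Sleep"
    unfolding eventually_at_left_field by blast
  define s where "s = (max c d + t) / 2"
  have "c \<le> s" "d < s" "s < t" using assms(1) d(1) by (auto simp: s_def)
  then show False using assms(2) d(2) by blast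
qed

lemma emeasure_extend:
  assumes "step_fun (cut c h)" "v \<noteq> Sleep" "c \<le> t" "{s. c \<le> s \<and> s < t \<and> h s = v} \<in> sets borel"
  shows "emeasure lborel {s. s < t \<and> h s = v}
    = emeasure lborel {s. s < c \<and> h s = v} + emeasure lborel {s. c \<le> s \<and> s < t \<and> h s = v}"
proof -
  have "{s. s < c \<and> h s = v} = {s. cut c h s = v}" using assms(2) by (auto simp: cut_def)
  then have "{s. s < c \<and> h s = v} \<in> sets borel"
    using step_fun_sets[OF assms(1), of "\<lambda>w. w = v"] by simp
  moreover have "{s. s < t \<and> h s = v} = {s. s < c \<and> h s = v} \<union> {s. c \<le> s \<and> s < t \<and> h s = v}"
    using assms(3) by auto
  ultimately show ?thesis using assms(4) by (simp add: plus_emeasure disjoint_iff)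
qed

lemma step_fun_extend:
  assumes "step_fun (cut c h)" "c \<le> t" "wf_queue q" "0 \<le> \<beta>"
    and h: "\<And>s. c \<le> s \<Longrightarrow> s < t \<Longrightarrow> h s = run q \<beta> c s"
  shows "step_fun (cut t h)"
proof -
  obtain B where B: "finite B" "\<And>s s'. s \<le> s' \<Longrightarrow> (\<And>b. b \<in> B \<Longrightarrow> b \<le> s \<or> s' < b) \<Longrightarrow> cut c h s = cut c h s'"
    using assms(1) by (rule step_funE) blast
  obtain B' where B': "finite B'"
    "\<And>s s'. c \<le> s \<Longrightarrow> s \<le> s' \<Longrightarrow> \<forall>b\<in>B'. b \<le> s \<or> s' < b \<Longrightarrow> run q \<beta> c s = run q \<beta> c s'"
    using run_step[OF assms(3,4), of c] by metis
  have "cut t h s = cut t h s'"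
    if s: "s \<le> s'" "\<forall>b\<in>insert c (insert t (B \<union> B')). b \<le> s \<or> s' < b" for s s'
  proof -
    consider "s' < c" | "c \<le> s" "s' < t" | "t \<le> s" using s assms(2) by force
    then show ?thesis
    proof cases
      case 1
      then have "cut c h s = h s" "cut c h s' = h s'" "cut t h s = h s" "cut t h s' = h s'"
        using s assms(2) by (auto simp: cut_def)
      moreover have "cut c h s = cut c h s'" using s by (intro B(2)) auto
      ultimately show ?thesis by simp
    next
      case 2
      then have "run q \<beta> c s = run q \<beta> c s'" using s by (intro B'(2)) auto
      then show ?thesis using 2 s h[of s] h[of s'] by (simp add: cut_def)
    next
      case 3
      then show ?thesis using s by (simp add: cut_def)
    qed
  qed
  then show ?thesis unfolding step_fun_iff using B(1) B'(1)
    by (intro exI[of _ "insert c (insert t (B \<union> B'))"]) blast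
qed

text \<open>The increment of the idle time is written as allowance before minus allowance after, so
  that idle time plus allowance is visibly constant. No turn-on lies strictly between c and t, since
  a run is awake exactly on an initial segment; one at c is covered by the clause of
  \<open>history\<close> for machines that are on.\<close>

lemma history_run:
  assumes hist: "history c is_on h D I" and "c \<le> t" "wf_queue q" "0 \<le> \<beta>"
    and h: "\<And>s. c \<le> s \<Longrightarrow> s < t \<Longrightarrow> h s = run q \<beta> c s"
    and is_on: "q \<noteq> [] \<or> 0 < \<beta> \<Longrightarrow> is_on"
    and is_on': "is_on' \<Longrightarrow> is_on \<and> t - c \<le> workload q + \<beta>"
  shows "history t is_on' h D (I + (\<beta> - max 0 (\<beta> - max 0 (t - c - workload q))))"
proof -
  let ?d = "\<beta> - max 0 (\<beta> - max 0 (t - c - workload q))"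
  have step: "step_fun (cut c h)" and I: "0 \<le> I" "emeasure lborel {t. t < c \<and> h t = Idle} = ennreal I"
    using hist by (auto simp: history_def)
  have wl: "0 \<le> workload q" using assms(3) by (rule workload_nonneg)
  have awake: "h s \<noteq> Sleep" if "c \<le> s" "s < t" "s < c + workload q + \<beta>" for s
    using that h[of s] run_eq_Sleep_iff[OF assms(3,4), of c s] by simp
  have "{s. c \<le> s \<and> s < t \<and> h s = Idle} = {s. c \<le> s \<and> s < c + (t - c) \<and> run q \<beta> c s = Idle}"
    using h by auto
  also have "\<dots> = {c + workload q..<min (c + (t - c)) (c + workload q + \<beta>)}"
    using assms by (intro run_Idle) auto
  finally have idle: "{s. c \<le> s \<and> s < t \<and> h s = Idle} = {c + workload q..<min t (c + workload q + \<beta>)}"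
    by simp
  have "emeasure lborel {c + workload q..<min t (c + workload q + \<beta>)} = ennreal ?d"
    using assms(4) by (cases "c + workload q \<le> t") (auto simp: min_def max_def intro!: arg_cong[where f = ennreal])
  then have "emeasure lborel {s. s < t \<and> h s = Idle} = ennreal I + ennreal ?d"
    using emeasure_extend[OF step _ assms(2), of Idle] idle I by simp
  also have "\<dots> = ennreal (I + ?d)"
    using I assms(4) by (intro ennreal_plus[symmetric]) auto
  finally have idle': "emeasure lborel {s. s < t \<and> h s = Idle} = ennreal (I + ?d)" .
  have on: "is_on' \<longrightarrow> t \<in> D \<or> \<not> (\<forall>\<^sub>F s in at_left t. h s = Sleep)"
  proof
    assume "is_on'"
    then have le: "is_on" "t \<le> c + workload q + \<beta>" using is_on' by auto
    show "t \<in> D \<or> \<not> (\<forall>\<^sub>F s in at_left t. h s = Sleep)"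
    proof (cases "c = t")
      case True
      then show ?thesis using hist le by (auto simp: history_def)
    next
      case False
      then show ?thesis using assms(2) le awake by (intro disjI2 not_eventually_Sleep[of c]) auto
    qed
  qed
  have "t0 \<in> D" if t0: "t0 \<in> turn_ons h" "t0 < t" for t0
  proof -
    have ev: "h t0 \<noteq> Sleep" "\<forall>\<^sub>F s in at_left t0. h s = Sleep" using t0 by (auto simp: turn_ons_def)
    consider "t0 < c" | "t0 = c" | "c < t0" by linarith
    then show ?thesis
    proof cases
      case 1
      then show ?thesis using hist t0 by (auto simp: history_def)
    next
      case 2
      then have "\<not> c + workload q + \<beta> \<le> c"
        using ev(1) h[of c] t0 run_eq_Sleep_iff[OF assms(3,4), of c c] by auto
      then have "q \<noteq> [] \<or> 0 < \<beta>" by (cases "q = []") auto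
      then show ?thesis using is_on hist 2 ev by (auto simp: history_def)
    next
      case 3
      then have "t0 < c + workload q + \<beta>"
        using ev(1) h[of t0] t0 run_eq_Sleep_iff[OF assms(3,4), of c t0] by auto
      then have False using ev(2) not_eventually_Sleep[OF 3, of h] awake t0 by auto
      then show ?thesis ..
    qed
  qed
  then show ?thesis
    unfolding history_def using step_fun_extend[OF step assms(2,3,4) h] hist idle' on I assms(4)
    by (auto simp: history_def)
qed


section \<open>Demand of queues\<close>

text \<open>
  \<open>X\<close> is the set of jobs that have arrived by time \<open>c\<close>.  A queue is fresh with respect to the
  deadline \<open>x\<close> if its machine has been working since some time \<open>l\<close> only on jobs that arrived
  after \<open>l\<close> and are due by \<open>x\<close>.  It is loaded if the machine has been doing so since the start
  \<open>\<tau>\<close> of the phase, but on jobs that may have been pending at time \<open>\<tau>\<close>.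
\<close>

definition fresh :: "job set \<Rightarrow> queue \<Rightarrow> real \<Rightarrow> real \<Rightarrow> bool" where
  "fresh X q c x \<longleftrightarrow> (\<exists>l\<le>c. W q x + (c - l) \<le> due {j \<in> X. l \<le> arr j} x)"

definition loaded :: "job set \<Rightarrow> job set \<Rightarrow> real \<Rightarrow> queue \<Rightarrow> real \<Rightarrow> real \<Rightarrow> bool" where
  "loaded U X \<tau> q c x \<longleftrightarrow> \<tau> + 1/2 \<le> x \<and> W q x + (c - \<tau>) \<le> due (U \<inter> X) x"

definition edf_feasible :: "queue \<Rightarrow> real \<Rightarrow> bool" where
  "edf_feasible q c \<longleftrightarrow> (\<forall>x. W q x \<le> max 0 (x - c))"

lemma due_insert:
  assumes "finite X" "j \<notin> X"
  shows "due (insert j X) x = due X x + (if dl j \<le> x then proc j else 0)"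
proof -
  have "{i \<in> insert j X. dl i \<le> x} = (if dl j \<le> x then insert j {i \<in> X. dl i \<le> x} else {i \<in> X. dl i \<le> x})"
    by auto
  then show ?thesis using assms by (simp add: due_def)
qed

lemma edf_feasible_serve:
  assumes "wf_queue q" "c \<le> t" "edf_feasible q c"
  shows "edf_feasible (serve (t - c) q) t"
  unfolding edf_feasible_def
proof
  fix x
  have "W q x \<le> max 0 (x - c)" using assms(3) by (simp add: edf_feasible_def)
  then show "W (serve (t - c) q) x \<le> max 0 (x - t)" using assms by (simp add: W_serve)
qed

lemma fresh_zero:
  assumes "\<forall>j\<in>X. 0 < proc j" "W q x \<le> 0"
  shows "fresh X q c x"
  unfolding fresh_def using assms due_nonneg[of "{j \<in> X. c \<le> arr j}" x] by (intro exI[of _ c]) auto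

text \<open>While work due by x is left, EDF does nothing else: \<open>W q x\<close> falls as fast
  as \<open>c - l\<close> grows, and the same l works. Once it is exhausted, l restarts at
  t.\<close>

lemma fresh_serve:
  assumes "\<forall>j\<in>X. 0 < proc j" "wf_queue q" "c \<le> t" "fresh X q c x"
  shows "fresh X (serve (t - c) q) t x"
proof (cases "W q x \<le> t - c")
  case True
  then show ?thesis using assms by (intro fresh_zero) (auto simp: W_serve)
next
  case False
  from assms obtain l where "l \<le> c" "W q x + (c - l) \<le> due {j \<in> X. l \<le> arr j} x"
    by (auto simp: fresh_def)
  then show ?thesis using assms False unfolding fresh_def by (intro exI[of _ l]) (auto simp: W_serve)
qed

lemma fresh_insert:
  assumes "finite X" "\<forall>j\<in>insert i X. 0 < proc j" "fresh X q c x"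
  shows "fresh (insert i X) q c x"
proof -
  from assms obtain l where l: "l \<le> c" "W q x + (c - l) \<le> due {j \<in> X. l \<le> arr j} x"
    by (auto simp: fresh_def)
  moreover have "due {j \<in> X. l \<le> arr j} x \<le> due {j \<in> insert i X. l \<le> arr j} x"
    using assms by (intro due_mono) auto
  ultimately show ?thesis unfolding fresh_def by (intro exI[of _ l]) auto
qed

text \<open>A job that arrives now arrives after l, so it adds the same amount to the demand as to
  the queue. No availability test is involved.\<close>

lemma fresh_enqueue:
  assumes "finite X" "i \<notin> X" "arr i = c" "fresh X q c x"
  shows "fresh (insert i X) (enqueue i q) c x"
proof -
  from assms obtain l where l: "l \<le> c" "W q x + (c - l) \<le> due {j \<in> X. l \<le> arr j} x"
    by (auto simp: fresh_def)
  have "{j \<in> insert i X. l \<le> arr j} = insert i {j \<in> X. l \<le> arr j}" using l assms by auto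
  then have "W (enqueue i q) x + (c - l) \<le> due {j \<in> insert i X. l \<le> arr j} x"
    using l assms by (simp add: due_insert W_enqueue)
  then show ?thesis using l(1) unfolding fresh_def by blast
qed

text \<open>The comparison with \<open>t - c\<close> is kept in the conclusion because a queue that
  remains loaded must have kept its machine busy until t; \<open>phase_pre_work\<close> derives from
  it that no idle time has accrued.\<close>

lemma loaded_serve:
  assumes "\<forall>j\<in>X. 0 < proc j" "wf_queue q" "c \<le> t" "loaded U X \<tau> q c x"
  shows "W q x \<le> t - c \<and> fresh X (serve (t - c) q) t x
         \<or> t - c < W q x \<and> loaded U X \<tau> (serve (t - c) q) t x"
proof (cases "W q x \<le> t - c")
  case True
  then show ?thesis using assms by (intro disjI1 conjI fresh_zero) (auto simp: W_serve)
next
  case False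
  then show ?thesis using assms by (auto simp: W_serve loaded_def)
qed

lemma loaded_insert:
  assumes "finite X" "\<forall>j\<in>insert i X. 0 < proc j" "loaded U X \<tau> q c x"
  shows "loaded U (insert i X) \<tau> q c x"
proof -
  have "due (U \<inter> X) x \<le> due (U \<inter> insert i X) x" using assms by (intro due_mono) auto
  then show ?thesis using assms by (auto simp: loaded_def)
qed

lemma loaded_enqueue:
  assumes "finite X" "i \<notin> X" "i \<in> U" "loaded U X \<tau> q c x"
  shows "loaded U (insert i X) \<tau> (enqueue i q) c x"
proof -
  have "U \<inter> insert i X = insert i (U \<inter> X)" using assms by auto
  then show ?thesis using assms by (simp add: loaded_def due_insert W_enqueue)
qed

lemma workload_ge_W: "wf_queue q \<Longrightarrow> W q x \<le> workload q"
  by (induction q) (auto simp: wf_queue_Cons)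


section \<open>Urgency\<close>

lemma urgent_iff:
  assumes "wf_queue q"
  shows "urgent u q t \<longleftrightarrow> (\<exists>x. 0 < W q x \<and> x - W q x - u \<le> t)"
proof
  assume "urgent u q t"
  then obtain s x where "s < x" "x - s \<le> W q x" "s - u \<le> t" by (auto simp: urgent_def)
  then show "\<exists>x. 0 < W q x \<and> x - W q x - u \<le> t" by (intro exI[of _ x]) auto
next
  assume "\<exists>x. 0 < W q x \<and> x - W q x - u \<le> t"
  then obtain x where "0 < W q x" "x - W q x - u \<le> t" by blast
  then show "urgent u q t" unfolding urgent_def by (intro exI[of _ "x - W q x"] exI[of _ x]) auto
qed

text \<open>\<open>W q\<close> increases only at deadlines, so the last deadline up to x can replace
  x. This leaves finitely many candidates for the moment of urgency.\<close>

lemma W_at_deadline: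
  "0 < W q x \<Longrightarrow> \<exists>(j, r)\<in>set q. dl j \<le> x \<and> W q (dl j) = W q x"
proof -
  assume pos: "0 < W q x"
  let ?D = "{dl j | j r. (j, r) \<in> set q \<and> dl j \<le> x}"
  have fin: "finite ?D"
    by (rule finite_subset[of _ "(\<lambda>(j, r). dl j) ` set q"]) force+
  have "?D \<noteq> {}"
  proof
    assume "?D = {}"
    then have "\<forall>(i, _)\<in>set q. x < dl i" by force
    then show False using W_later pos by fastforce
  qed
  then have "Max ?D \<in> ?D" using fin by (rule_tac Max_in)
  then obtain j r where j: "(j, r) \<in> set q" "dl j \<le> x" "dl j = Max ?D" by auto
  have "dl i \<le> dl j \<longleftrightarrow> dl i \<le> x" if "(i, r') \<in> set q" for i r'
    using that j Max_ge[OF fin, of "dl i"] by fastforce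
  then have "filter (\<lambda>(i, _). dl i \<le> dl j) q = filter (\<lambda>(i, _). dl i \<le> x) q"
    by (intro filter_cong) auto
  then have "W q (dl j) = W q x" by (simp add: W_def)
  then show ?thesis using j by blast
qed

text \<open>The first moment of urgency exists, so the infimum in the definition of \<open>elapse\<close> is attained.\<close>

lemma urgent_threshold:
  assumes "wf_queue q" "q \<noteq> []"
  shows "\<exists>\<tau>. \<forall>t. urgent u q t \<longleftrightarrow> \<tau> \<le> t"
proof -
  let ?T = "(\<lambda>(j, r). dl j - W q (dl j) - u) ` set q"
  have fin: "finite ?T" "?T \<noteq> {}" using assms by auto
  have "urgent u q t \<longleftrightarrow> Min ?T \<le> t" for t
  proof
    assume "urgent u q t"
    then obtain x where x: "0 < W q x" "x - W q x - u \<le> t" using urgent_iff[OF assms(1)] by blast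
    then obtain j r where j: "(j, r) \<in> set q" "dl j \<le> x" "W q (dl j) = W q x"
      using W_at_deadline by blast
    then have "dl j - W q (dl j) - u \<in> ?T" by force
    then have "Min ?T \<le> dl j - W q (dl j) - u" using fin by (intro Min_le) auto
    then show "Min ?T \<le> t" using j x by simp
  next
    assume le: "Min ?T \<le> t"
    have "Min ?T \<in> ?T" using fin by (rule Min_in)
    then obtain j r where j: "(j, r) \<in> set q" "Min ?T = dl j - W q (dl j) - u" by auto
    have "0 < r" using assms j by (auto simp: wf_queue_def)
    then have "0 < W q (dl j)" using W_ge[OF assms(1) j(1)] by linarith
    then show "urgent u q t" using urgent_iff[OF assms(1)] j(2) le by auto
  qed
  then show ?thesis by blast
qed


section \<open>Invariants of the algorithm\<close>

text \<open>Indexing by the physical machine makes the invariants insensitive to the swap of names,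
  which moves no job.\<close>

definition queue_of :: "state \<Rightarrow> machine \<Rightarrow> queue" where
  "queue_of st m = (if m = prim st then QP st else QS st)"

definition on_of :: "state \<Rightarrow> machine \<Rightarrow> bool" where
  "on_of st m = (if m = prim st then onP st else onS st)"

text \<open>The time for which a machine may still be idle before it is turned off.\<close>

definition budget :: "real \<Rightarrow> state \<Rightarrow> machine \<Rightarrow> real" where
  "budget \<psi> st m = (if m = prim st \<and> onP st then 2 / \<psi> - idleP st else 0)"

definition mode_of :: "state \<Rightarrow> machine \<Rightarrow> mode" where
  "mode_of st m = current_mode (on_of st m) (queue_of st m)"

definition wf_state :: "real \<Rightarrow> state \<Rightarrow> bool" where
  "wf_state \<psi> st \<longleftrightarrow>
     wf_queue (Q st) \<and> wf_queue (QP st) \<and> wf_queue (QS st) \<and>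
     (QP st \<noteq> [] \<longrightarrow> onP st) \<and> (QS st \<noteq> [] \<longrightarrow> onS st) \<and> (onP st \<or> onS st \<longrightarrow> Q st = []) \<and>
     0 \<le> idleP st \<and> (onP st \<longrightarrow> idleP st \<le> 2 / \<psi>)"

lemma wf_queue_of: "wf_state \<psi> st \<Longrightarrow> wf_queue (queue_of st m)"
  by (simp add: wf_state_def queue_of_def)

lemma budget_nonneg: "wf_state \<psi> st \<Longrightarrow> 0 \<le> budget \<psi> st m"
  by (simp add: wf_state_def budget_def)

lemma on_of_if_active: "wf_state \<psi> st \<Longrightarrow> queue_of st m \<noteq> [] \<or> 0 < budget \<psi> st m \<Longrightarrow> on_of st m"
  by (auto simp: wf_state_def budget_def on_of_def queue_of_def split: if_splits)

lemma queue_of_work_until: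
  "queue_of (work_until \<psi> t st) m = serve (t - clock st) (queue_of st m)"
  by (simp add: queue_of_def work_until_def Let_def)

text \<open>\<open>work_until\<close> keeps a machine on at the very moment its allowance expires
  and \<open>switch_off\<close> then ends it, so the visible mode is the right-continuous
  \<open>run\<close>.\<close>

lemma mode_of_work_until:
  assumes "wf_state \<psi> st" "clock st \<le> s"
  shows "mode_of (switch_off \<psi> (work_until \<psi> s st)) m
           = run (queue_of st m) (budget \<psi> st m) (clock st) s"
proof (cases "m = prim st")
  case True
  let ?q = "QP st" and ?d = "s - clock st"
  have wf: "wf_queue ?q" "?q \<noteq> [] \<Longrightarrow> onP st" "onP st \<Longrightarrow> idleP st \<le> 2 / \<psi>"
    using assms by (auto simp: wf_state_def)
  show ?thesis
  proof (cases "serve ?d ?q")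
    case Nil
    then have "workload ?q \<le> ?d" using serve_eq_Nil_iff[OF wf(1)] assms by auto
    moreover have "\<not> onP st \<Longrightarrow> workload ?q = 0" using wf(2) by (cases "?q = []") auto
    ultimately show ?thesis
      using True Nil assms
      by (auto simp: mode_of_def switch_off_def work_until_def Let_def run_def queue_of_def on_of_def
          budget_def current_mode_def)
  next
    case (Cons a q')
    then have "?q \<noteq> []" "\<not> workload ?q \<le> ?d" using serve_eq_Nil_iff[OF wf(1), of ?d] assms by auto
    then show ?thesis
      using True Cons wf
      by (auto simp: mode_of_def switch_off_def work_until_def Let_def run_def queue_of_def on_of_def
          budget_def current_mode_def split: prod.splits)
  qed
next
  case False
  let ?q = "QS st" and ?d = "s - clock st"
  have wf: "wf_queue ?q" "?q \<noteq> [] \<Longrightarrow> onS st" using assms by (auto simp: wf_state_def)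
  show ?thesis
  proof (cases "serve ?d ?q")
    case Nil
    then have "workload ?q \<le> ?d" using serve_eq_Nil_iff[OF wf(1)] assms by auto
    then show ?thesis
      using False Nil assms
      by (auto simp: mode_of_def switch_off_def work_until_def Let_def run_def queue_of_def on_of_def
          budget_def current_mode_def)
  next
    case (Cons a q')
    then have "?q \<noteq> []" "\<not> workload ?q \<le> ?d" using serve_eq_Nil_iff[OF wf(1), of ?d] assms by auto
    then show ?thesis
      using False Cons wf
      by (auto simp: mode_of_def switch_off_def work_until_def Let_def run_def queue_of_def on_of_def
          budget_def current_mode_def split: prod.splits)
  qed
qed

lemma mode_of_off:
  assumes "wf_state \<psi> st" "\<not> onP st" "\<not> onS st"
  shows "mode_of (switch_off \<psi> (st\<lparr>clock := s\<rparr>)) m = Sleep"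
  using assms by (simp add: mode_of_def switch_off_def on_of_def current_mode_def)

lemma wf_state_work_until:
  assumes "wf_state \<psi> st" "clock st \<le> t"
  shows "wf_state \<psi> (work_until \<psi> t st)"
proof -
  have "onP (work_until \<psi> t st)" if "serve (t - clock st) (QP st) \<noteq> []"
  proof -
    have "\<not> workload (QP st) \<le> t - clock st" "QP st \<noteq> []"
      using that serve_eq_Nil_iff[of "QP st" "t - clock st"] assms by (auto simp: wf_state_def)
    then show ?thesis using assms by (auto simp: wf_state_def work_until_def Let_def)
  qed
  moreover have "onS (work_until \<psi> t st)" if "serve (t - clock st) (QS st) \<noteq> []"
  proof -
    have "\<not> workload (QS st) \<le> t - clock st" "QS st \<noteq> []"
      using that serve_eq_Nil_iff[of "QS st" "t - clock st"] assms by (auto simp: wf_state_def)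
    then show ?thesis using assms by (auto simp: wf_state_def work_until_def Let_def)
  qed
  ultimately show ?thesis
    using assms by (auto simp: wf_state_def work_until_def Let_def wf_queue_serve)
qed

text \<open>
  Machine \<open>m\<close> is the only one that has executed or will execute \<open>j\<close>; a pending job will be
  executed by the primary machine.
\<close>

definition owns :: "state \<Rightarrow> (machine \<Rightarrow> real \<Rightarrow> mode) \<Rightarrow> job \<Rightarrow> machine \<Rightarrow> bool" where
  "owns st h j m \<longleftrightarrow>
     (j \<in> fst ` set (Q st) \<longrightarrow> m = prim st) \<and>
     remaining (Q st) j + remaining (queue_of st m) j \<le> proc j \<and>
     emeasure lborel {t. t < clock st \<and> h m t = Busy j}
       = ennreal (proc j - remaining (Q st) j - remaining (queue_of st m) j) \<and>
     (\<forall>m'. m' \<noteq> m \<longrightarrow> j \<notin> fst ` set (queue_of st m') \<and> (\<forall>t<clock st. h m' t \<noteq> Busy j))"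

lemma UNIV_machine: "(UNIV :: machine set) = {M1, M2}"
  using machine.exhaust by auto

lemma sum_machine: "(\<Sum>m\<in>UNIV. g m) = g M1 + g M2" for g :: "machine \<Rightarrow> 'a::comm_monoid_add"
  by (simp add: UNIV_machine)

lemma other_neq [simp]: "other m \<noteq> m" "m \<noteq> other m"
  by (cases m; simp)+

lemma neq_machine_iff: "m' \<noteq> m \<longleftrightarrow> m' = other m"
  by (cases m; cases m'; simp)

lemma sum_machine_other: "(\<Sum>m\<in>UNIV. g m) = g m + g (other m)" for g :: "machine \<Rightarrow> 'a::comm_monoid_add"
  by (cases m) (simp_all add: sum_machine add.commute)

section \<open>Preservation of deadlines, job ownership and energy accounts\<close>

locale online_run =
  fixes \<psi> :: real and js :: "job list" and m\<^sub>0 :: machine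
  assumes psi: "0 < \<psi>" "\<psi> \<le> 1"
    and seq: "job_sequence js"
    and sched: "single_machine_schedulable (set js)"
begin

abbreviation "J \<equiv> set js"

abbreviation "sch \<equiv> algA \<psi> (1/2) m\<^sub>0 js"

lemma proc_pos: "j \<in> J \<Longrightarrow> 0 < proc j"
  using seq by (auto simp: job_sequence_def)

lemma arr_less_dl:
  assumes "j \<in> J"
  shows "arr j < dl j"
proof (rule ccontr)
  assume "\<not> arr j < dl j"
  \<comment> \<open>If the deadline were not after the arrival, the job would fit into this window,
    whose length is only \<open>proc j / 2\<close>.\<close>
  define l r where "l = arr j - proc j / 4" and "r = arr j + proc j / 4"
  have p: "0 < proc j" using assms by (rule proc_pos)
  then have "l < r" by (simp add: l_def r_def)
  have "proc j \<le> (\<Sum>i\<in>{i \<in> J. l \<le> arr i \<and> dl i \<le> r}. proc i)"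
  proof (rule member_le_sum)
    show "j \<in> {i \<in> J. l \<le> arr i \<and> dl i \<le> r}"
      using assms \<open>\<not> arr j < dl j\<close> p by (simp add: l_def r_def)
  qed (use proc_pos in \<open>auto intro: less_imp_le\<close>)
  also have "\<dots> \<le> r - l" using sched \<open>l < r\<close> by (simp add: single_machine_schedulable_def)
  finally show False using p by (simp add: l_def r_def)
qed

lemma due_arrivals_le:
  assumes "X \<subseteq> J"
  shows "due {j \<in> X. l \<le> arr j} x \<le> max 0 (x - l)"
proof (cases "l < x")
  case True
  have "due {j \<in> X. l \<le> arr j} x \<le> (\<Sum>j\<in>{j \<in> J. l \<le> arr j \<and> dl j \<le> x}. proc j)"
    unfolding due_def using assms proc_pos by (intro sum_mono2) (auto intro: less_imp_le)
  also have "\<dots> \<le> x - l" using sched True by (simp add: single_machine_schedulable_def)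
  finally show ?thesis by simp
next
  case False
  then have "{j \<in> {j \<in> X. l \<le> arr j}. dl j \<le> x} = {}" using assms arr_less_dl by fastforce
  then have "due {j \<in> X. l \<le> arr j} x = 0" unfolding due_def by (simp only: sum.empty)
  then show ?thesis by simp
qed

text \<open>At most \<open>x - l\<close> units arrive from l on and are due by x, and
  \<open>c - l\<close> units of them are accounted for as done by time c, which leaves at most
  \<open>x - c\<close>.\<close>

lemma fresh_feasible:
  assumes "X \<subseteq> J" "wf_queue q" "\<And>x. fresh X q c x"
  shows "edf_feasible q c"
  unfolding edf_feasible_def
proof
  fix x
  obtain l where "l \<le> c" "W q x + (c - l) \<le> due {j \<in> X. l \<le> arr j} x"
    using assms(3)[of x] by (auto simp: fresh_def)
  then show "W q x \<le> max 0 (x - c)" using due_arrivals_le[OF assms(1), of l x] by (auto simp: max_def split: if_splits)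
qed

lemma not_fresh:
  assumes "X \<subseteq> J" "max 0 (x - c) < W q x"
  shows "\<not> fresh X q c x"
proof
  assume "fresh X q c x"
  then obtain l where "l \<le> c" "W q x + (c - l) \<le> due {j \<in> X. l \<le> arr j} x" by (auto simp: fresh_def)
  then show False using assms due_arrivals_le[OF assms(1), of l x] by (auto simp: max_def split: if_splits)
qed

lemma available_feasible:
  assumes "edf_feasible q (arr j)" "available q (arr j) j" "j \<in> J"
  shows "edf_feasible (enqueue j q) (arr j)"
  unfolding edf_feasible_def
proof
  fix x
  show "W (enqueue j q) x \<le> max 0 (x - arr j)"
  proof (cases "arr j \<le> x")
    case True
    then show ?thesis using assms(2) by (fastforce simp: available_def not_less)
  next
    case False
    moreover have "W q x \<le> max 0 (x - arr j)" using assms(1) by (simp add: edf_feasible_def)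
    ultimately show ?thesis using arr_less_dl[OF assms(3)] by (simp add: W_enqueue)
  qed
qed

definition core :: "job set \<Rightarrow> job set \<Rightarrow> state \<Rightarrow> (machine \<Rightarrow> real set) \<Rightarrow> (machine \<Rightarrow> real) \<Rightarrow> real \<Rightarrow> bool"
  where
  "core X Y st D I C \<longleftrightarrow>
     X \<union> Y = J \<and> X \<inter> Y = {} \<and> (\<forall>j\<in>X. arr j \<le> clock st) \<and> (\<forall>j\<in>Y. clock st \<le> arr j) \<and>
     wf_state \<psi> st \<and> (\<forall>m. edf_feasible (queue_of st m) (clock st)) \<and>
     (\<forall>m. history (clock st) (on_of st m) (sch m) (D m) (I m)) \<and>
     fst ` set (Q st) \<subseteq> X \<and> (\<forall>m. fst ` set (queue_of st m) \<subseteq> X) \<and>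
     (\<forall>m t j. t < clock st \<and> sch m t = Busy j \<longrightarrow> j \<in> X \<and> t \<in> {arr j..dl j}) \<and>
     (\<forall>j\<in>X. \<exists>m. owns st sch j m) \<and>
     (\<Sum>m\<in>UNIV. card (D m) + \<psi> * (I m + budget \<psi> st m)) \<le> C"

text \<open>Common to running and to waiting, where the latter is a run of empty queues without
  allowance. Used allowance moves from \<open>budget\<close> to the idle time, so C stays the
  same.\<close>

lemma core_advance:
  assumes core: "core X Y st D I C"
    and t: "clock st \<le> t" "\<forall>j\<in>Y. t \<le> arr j"
    and sch: "\<And>m s. clock st \<le> s \<Longrightarrow> s < t \<Longrightarrow> sch m s = run (queue_of st m) (budget \<psi> st m) (clock st) s"
    and st': "clock st' = t" "prim st' = prim st" "Q st' = Q st" "wf_state \<psi> st'"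
      "\<And>m. queue_of st' m = serve (t - clock st) (queue_of st m)"
      "\<And>m. on_of st' m \<Longrightarrow> on_of st m \<and> t - clock st \<le> workload (queue_of st m) + budget \<psi> st m"
      "\<And>m. budget \<psi> st' m
         = max 0 (budget \<psi> st m - max 0 (t - clock st - workload (queue_of st m)))"
  shows "\<exists>I'. core X Y st' D I' C"
proof -
  let ?c = "clock st"
  let ?I = "\<lambda>m. I m + (budget \<psi> st m - budget \<psi> st' m)"
  have wf: "wf_state \<psi> st" using core by (simp add: core_def)
  note wfq = wf_queue_of[OF wf]
  have hist: "history ?c (on_of st m) (sch m) (D m) (I m)" for m using core by (simp add: core_def)
  have step: "step_fun (cut ?c (sch m))" for m using hist by (simp add: history_def)
  have feas: "edf_feasible (queue_of st m) ?c" for m using core by (simp add: core_def)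
  have sub: "fst ` set (queue_of st m) \<subseteq> X" for m using core by (simp add: core_def)
  have early: "arr j \<le> ?c" if "j \<in> X" for j using core that by (simp add: core_def)
  have hist': "history t (on_of st' m) (sch m) (D m) (?I m)" for m
    unfolding st'(7)
    by (rule history_run[OF hist[of m] t(1) wfq budget_nonneg[OF wf] sch on_of_if_active[OF wf] st'(6)])
  \<comment> \<open>After EDF until s the executed job still has r > 0 units left, and feasibility
    of the remaining queue at s bounds r by \<open>dl j - s\<close>.\<close>
  have seg: "j \<in> fst ` set (queue_of st m) \<and> arr j \<le> s \<and> s \<le> dl j"
    if s: "?c \<le> s" "s < t" "sch m s = Busy j" for m s j
  proof -
    obtain r q' where q': "serve (s - ?c) (queue_of st m) = (j, r) # q'"
      using s sch[OF s(1,2)] run_eq_BusyD by metis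
    have j: "j \<in> fst ` set (queue_of st m)"
      using fst_set_serve[of "s - ?c" "queue_of st m"] q' by auto
    have wf': "wf_queue ((j, r) # q')" using wf_queue_serve[OF wfq, of "s - ?c" m] q' by simp
    have "0 < r" using wf' by (simp add: wf_queue_Cons)
    moreover have "r \<le> W ((j, r) # q') (dl j)" by (rule W_ge[OF wf']) simp
    moreover have "edf_feasible ((j, r) # q') s"
      using edf_feasible_serve[OF wfq s(1) feas, of m] q' by simp
    then have "W ((j, r) # q') (dl j) \<le> max 0 (dl j - s)" unfolding edf_feasible_def by blast
    moreover have "arr j \<le> s" using j sub[of m] early[of j] s(1) by auto
    ultimately show ?thesis using j by (auto simp: max_def split: if_splits)
  qed
  have owns': "owns st' sch j m" if own: "owns st sch j m" for j m
  proof -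
    let ?q = "queue_of st m" and ?q' = "queue_of st' m"
    have "{s. ?c \<le> s \<and> s < t \<and> sch m s = Busy j}
       = {s. ?c \<le> s \<and> s < ?c + (t - ?c) \<and> run ?q (budget \<psi> st m) ?c s = Busy j}"
      using sch by auto
    with emeasure_run_Busy[OF wfq, of "t - ?c" ?c m "budget \<psi> st m" j] t(1)
    have b: "{s. ?c \<le> s \<and> s < t \<and> sch m s = Busy j} \<in> sets borel"
      "emeasure lborel {s. ?c \<le> s \<and> s < t \<and> sch m s = Busy j} = ennreal (remaining ?q j - remaining ?q' j)"
      unfolding st'(5) by auto
    have le: "remaining ?q' j \<le> remaining ?q j"
      unfolding st'(5) using wfq t(1) by (intro remaining_serve_le) auto
    have "emeasure lborel {s. s < t \<and> sch m s = Busy j}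
       = ennreal (proc j - remaining (Q st) j - remaining ?q j) + ennreal (remaining ?q j - remaining ?q' j)"
      using emeasure_extend[OF step _ t(1) b(1)] b(2) own by (simp add: owns_def)
    also have "\<dots> = ennreal (proc j - remaining (Q st) j - remaining ?q' j)"
      using own le by (subst ennreal_plus[symmetric]) (auto simp: owns_def)
    finally have "emeasure lborel {s. s < t \<and> sch m s = Busy j}
      = ennreal (proc j - remaining (Q st) j - remaining ?q' j)" .
    moreover have "j \<notin> fst ` set (queue_of st' m') \<and> (\<forall>s<t. sch m' s \<noteq> Busy j)" if "m' \<noteq> m" for m'
    proof -
      have o: "j \<notin> fst ` set (queue_of st m')" "\<forall>s<?c. sch m' s \<noteq> Busy j"
        using own that by (auto simp: owns_def)
      have "sch m' s \<noteq> Busy j" if "s < t" for s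
        using o seg[of s m' j] that by (cases "s < ?c") auto
      then show ?thesis using o fst_set_serve unfolding st'(5) by blast
    qed
    ultimately show ?thesis using own le st'(1-3) unfolding owns_def by auto
  qed
  have busy: "j \<in> X \<and> s \<in> {arr j..dl j}" if "s < t" "sch m s = Busy j" for m s j
  proof (cases "s < ?c")
    case True
    then show ?thesis using core that by (auto simp: core_def)
  next
    case False
    then show ?thesis using seg[of s m j] that sub[of m] by auto
  qed
  have sub': "fst ` set (queue_of st' m) \<subseteq> X" for m
    unfolding st'(5) using sub fst_set_serve by blast
  have feas': "edf_feasible (queue_of st' m) t" for m
    unfolding st'(5) using edf_feasible_serve[OF wfq t(1) feas] .
  have "core X Y st' D ?I C"
    unfolding core_def
  proof (intro conjI allI ballI impI)
    show "\<exists>m. owns st' sch j m" if "j \<in> X" for j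
    proof -
      have "\<exists>m. owns st sch j m" using core that by (simp add: core_def)
      then show ?thesis using owns' by blast
    qed
    show "arr j \<le> clock st'" if "j \<in> X" for j using early[OF that] t(1) st'(1) by simp
    show "(\<Sum>m\<in>UNIV. real (card (D m)) + \<psi> * (?I m + budget \<psi> st' m)) \<le> C"
      using core by (simp add: core_def)
    show "j \<in> X" "s \<in> {arr j..dl j}" if "s < clock st' \<and> sch m s = Busy j" for m s j
      using busy that st'(1) by auto
  qed (use core t(2) st'(1-4) hist' feas' sub' in \<open>auto simp: core_def\<close>)
  then show ?thesis by blast
qed

lemma core_work_until:
  assumes core: "core X Y st D I C"
    and t: "clock st \<le> t" "\<forall>j\<in>Y. t \<le> arr j"
    and sch: "\<And>m s. clock st \<le> s \<Longrightarrow> s < t \<Longrightarrow> sch m s = run (queue_of st m) (budget \<psi> st m) (clock st) s"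
  shows "\<exists>I'. core X Y (work_until \<psi> t st) D I' C"
proof (rule core_advance[OF core t sch])
  have wf: "wf_state \<psi> st" using core by (simp add: core_def)
  show "wf_state \<psi> (work_until \<psi> t st)" by (rule wf_state_work_until[OF wf t(1)])
  show "budget \<psi> (work_until \<psi> t st) m
         = max 0 (budget \<psi> st m - max 0 (t - clock st - workload (queue_of st m)))" for m
    using wf t(1) by (auto simp: budget_def work_until_def Let_def wf_state_def queue_of_def max_def)
  show "on_of st m \<and> t - clock st \<le> workload (queue_of st m) + budget \<psi> st m"
    if "on_of (work_until \<psi> t st) m" for m
    using wf that
    by (auto simp: budget_def work_until_def Let_def wf_state_def queue_of_def on_of_def split: if_splits)
qed (auto simp: work_until_def Let_def queue_of_def)

lemma core_wait:
  assumes core: "core X Y st D I C" and off: "\<not> onP st" "\<not> onS st"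
    and t: "clock st \<le> t" "\<forall>j\<in>Y. t \<le> arr j"
    and sch: "\<And>m s. clock st \<le> s \<Longrightarrow> s < t \<Longrightarrow> sch m s = Sleep"
  shows "\<exists>I'. core X Y (st\<lparr>clock := t\<rparr>) D I' C"
proof -
  have wf: "wf_state \<psi> st" using core by (simp add: core_def)
  have q: "QP st = []" "QS st = []" using wf off by (auto simp: wf_state_def)
  show ?thesis
  proof (rule core_advance[OF core t])
    show "sch m s = run (queue_of st m) (budget \<psi> st m) (clock st) s"
      if "clock st \<le> s" "s < t" for m s
      using sch[OF that] q off that by (simp add: queue_of_def budget_def run_Nil)
  qed (use wf q off in \<open>auto simp: queue_of_def budget_def on_of_def wf_state_def split: if_splits\<close>)
qed

text \<open>The 3 is the turn-on plus the idle allowance, \<psi> * (2 / \<psi>) = 2. Pending jobs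
  keep their owner, because \<open>owns\<close> has already assigned them to
  \<open>prim st\<close>.\<close>

lemma core_start:
  assumes core: "core X Y st D I C" and off: "\<not> onP st" "\<not> onS st"
    and feas: "edf_feasible (Q st) (clock st)"
  shows "\<exists>D'. core X Y (rule_1a st) D' I (C + 3)"
proof -
  let ?st = "rule_1a st" and ?p = "prim st"
  let ?D = "D(?p := insert (clock st) (D ?p))"
  have wf: "wf_state \<psi> st" using core by (simp add: core_def)
  have q: "QP st = []" "QS st = []" "\<And>m. queue_of st m = []"
    using wf off by (auto simp: wf_state_def queue_of_def)
  have q': "queue_of ?st m = (if m = ?p then Q st else [])" for m
    using q by (simp add: queue_of_def rule_1a_def)
  have hist: "history (clock st) (on_of st m) (sch m) (D m) (I m)" for m
    using core by (simp add: core_def)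
  have hist': "history (clock st) (on_of ?st m) (sch m) (?D m) (I m)" for m
    using hist[of m] off by (auto simp: history_def on_of_def rule_1a_def)
  have owns': "owns ?st sch j m" if "owns st sch j m" for j m
  proof -
    have "j \<notin> fst ` set (Q st)" if "m \<noteq> ?p"
      using \<open>owns st sch j m\<close> that by (auto simp: owns_def)
    then have "remaining (Q st) j = 0" if "m \<noteq> ?p" using that remaining_notin by blast
    then show ?thesis
      using that q q' \<open>m \<noteq> ?p \<Longrightarrow> j \<notin> fst ` set (Q st)\<close>
      by (cases "m = ?p") (auto simp: owns_def rule_1a_def)
  qed
  have "card (?D ?p) \<le> Suc (card (D ?p))" by (simp add: card_insert_if hist[of ?p, unfolded history_def])
  then have card: "real (card (?D ?p)) \<le> 1 + real (card (D ?p))" by simp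
  have C: "(\<Sum>m\<in>UNIV. card (D m) + \<psi> * (I m + budget \<psi> st m)) \<le> C" using core by (simp add: core_def)
  have "(\<Sum>m\<in>UNIV. card (?D m) + \<psi> * (I m + budget \<psi> ?st m)) \<le> C + 3"
    using C card psi off unfolding sum_machine_other[where m = ?p]
    by (simp add: budget_def rule_1a_def algebra_simps)
  moreover have "wf_state \<psi> ?st" using wf off psi by (auto simp: wf_state_def rule_1a_def)
  moreover have "edf_feasible (queue_of ?st m) (clock st)" for m
    using feas by (simp add: q' edf_feasible_def)
  moreover have "fst ` set (queue_of ?st m) \<subseteq> X" for m using core by (auto simp: q' core_def)
  moreover have "clock ?st = clock st" "Q ?st = []" by (auto simp: rule_1a_def)
  moreover have "\<forall>j\<in>X. \<exists>m. owns ?st sch j m" 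
  proof -
    have "\<forall>j\<in>X. \<exists>m. owns st sch j m" using core by (simp add: core_def)
    then show ?thesis using owns' by blast
  qed
  moreover have "\<forall>m t j. t < clock st \<and> sch m t = Busy j \<longrightarrow> j \<in> X \<and> t \<in> {arr j..dl j}"
    using core unfolding core_def by (elim conjE)
  ultimately have "core X Y ?st ?D I (C + 3)"
    unfolding core_def using core hist' by (simp add: core_def) blast
  then show ?thesis by blast
qed

text \<open>The new job has not been executed before its arrival, so whichever machine receives it
  owns it; every machine that becomes on must have the current time among its turn-ons.\<close>

lemma core_arrive:
  assumes core: "core X Y st D I C" and j: "j \<in> Y" "arr j = clock st"
    and st': "clock st' = clock st" "wf_state \<psi> st'" "\<And>m. edf_feasible (queue_of st' m) (clock st)"
    and queues: "Q st' = enqueue j (Q st) \<and> prim st' = prim st \<and> (\<forall>m. queue_of st' m = queue_of st m) \<or>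
      Q st = [] \<and> Q st' = [] \<and> (\<exists>m. queue_of st' m = enqueue j (queue_of st m) \<and>
         (\<forall>m'. m' \<noteq> m \<longrightarrow> queue_of st' m' = queue_of st m'))"
    and D': "\<And>m. finite (D' m)" "\<And>m. D m \<subseteq> D' m" "\<And>m. on_of st' m \<Longrightarrow> on_of st m \<or> clock st \<in> D' m"
    and C': "(\<Sum>m\<in>UNIV. card (D' m) + \<psi> * (I m + budget \<psi> st' m)) \<le> C'"
  shows "core (insert j X) (Y - {j}) st' D' I C'"
proof -
  let ?c = "clock st"
  have jX: "j \<notin> X" and XJ: "X \<subseteq> J" using core j by (auto simp: core_def)
  have sub: "fst ` set (Q st) \<subseteq> X" "\<And>m. fst ` set (queue_of st m) \<subseteq> X" using core by (auto simp: core_def)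
  have busy: "i \<in> X \<and> t \<in> {arr i..dl i}" if "t < ?c" "sch m t = Busy i" for m t i
    using core that by (simp add: core_def)
  have jQ: "remaining (Q st) j = 0" "\<And>m. remaining (queue_of st m) j = 0"
    by (rule remaining_notin, use jX sub in blast)+
  have nobusy: "\<forall>t<?c. sch m t \<noteq> Busy j" for m using busy jX by blast
  then have nobusy': "emeasure lborel {t. t < ?c \<and> sch m t = Busy j} = 0" for m
    by (metis (mono_tags, lifting) Collect_empty_eq emeasure_empty)
  have notin: "j \<notin> fst ` set (queue_of st m)" for m using jX sub by blast
  have hist: "history ?c (on_of st' m) (sch m) (D' m) (I m)" for m
  proof -
    have "history ?c (on_of st m) (sch m) (D m) (I m)" using core by (simp add: core_def)
    then show ?thesis using D'(1,2,3)[of m] unfolding history_def by blast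
  qed
  have "fst ` set (Q st') \<subseteq> insert j X \<and> (\<forall>m. fst ` set (queue_of st' m) \<subseteq> insert j X)"
    using queues
  proof
    assume "Q st' = enqueue j (Q st) \<and> prim st' = prim st \<and> (\<forall>m. queue_of st' m = queue_of st m)"
    then show ?thesis using sub by (simp add: set_enqueue subset_insertI2)
  next
    assume "Q st = [] \<and> Q st' = [] \<and> (\<exists>m. queue_of st' m = enqueue j (queue_of st m) \<and>
         (\<forall>m'. m' \<noteq> m \<longrightarrow> queue_of st' m' = queue_of st m'))"
    then obtain m where m: "Q st' = []" "queue_of st' m = enqueue j (queue_of st m)"
      "\<And>m'. m' \<noteq> m \<Longrightarrow> queue_of st' m' = queue_of st m'" by blast
    have "fst ` set (queue_of st' m') \<subseteq> insert j X" for m'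
      using m sub(2)[of m'] by (cases "m' = m") (auto simp: set_enqueue)
    then show ?thesis using m(1) by simp
  qed
  moreover have "\<exists>m. owns st' sch i m" if i: "i \<in> insert j X" for i
    using queues
  proof
    assume q: "Q st' = enqueue j (Q st) \<and> prim st' = prim st \<and> (\<forall>m. queue_of st' m = queue_of st m)"
    show ?thesis
    proof (cases "i = j")
      case True
      have "owns st' sch j (prim st)"
        using q jQ nobusy nobusy' notin st'(1) unfolding owns_def
        by (simp add: remaining_enqueue)
      then show ?thesis using True by blast
    next
      case False
      then obtain m where "owns st sch i m" using i core by (auto simp: core_def)
      then have "owns st' sch i m"
        using q False st'(1) unfolding owns_def by (auto simp: remaining_enqueue set_enqueue)
      then show ?thesis by blast
    qed
  next
    assume "Q st = [] \<and> Q st' = [] \<and> (\<exists>m. queue_of st' m = enqueue j (queue_of st m) \<and>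
         (\<forall>m'. m' \<noteq> m \<longrightarrow> queue_of st' m' = queue_of st m'))"
    then obtain m where m: "Q st = []" "Q st' = []" "queue_of st' m = enqueue j (queue_of st m)"
      "\<And>m'. m' \<noteq> m \<Longrightarrow> queue_of st' m' = queue_of st m'" by blast
    show ?thesis
    proof (cases "i = j")
      case True
      have "owns st' sch j m"
        using m jQ nobusy nobusy' notin st'(1) unfolding owns_def
        by (simp add: remaining_enqueue)
      then show ?thesis using True by blast
    next
      case False
      have r: "remaining (queue_of st' m') i = remaining (queue_of st m') i" for m'
        using m False by (cases "m' = m") (auto simp: remaining_enqueue)
      have f: "i \<in> fst ` set (queue_of st' m') \<longleftrightarrow> i \<in> fst ` set (queue_of st m')" for m'
        using m False by (cases "m' = m") (auto simp: set_enqueue)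
      obtain m' where "owns st sch i m'" using i False core by (auto simp: core_def)
      then have "owns st' sch i m'" using m(1,2) st'(1) unfolding owns_def r f by simp
      then show ?thesis by blast
    qed
  qed
  moreover have "insert j X \<union> (Y - {j}) = J" "insert j X \<inter> (Y - {j}) = {}"
    "\<forall>i\<in>insert j X. arr i \<le> ?c" "\<forall>i\<in>Y - {j}. ?c \<le> arr i"
    using core j by (auto simp: core_def)
  ultimately show ?thesis
    unfolding core_def using st' hist busy C' by auto
qed

end

lemma queue_of_simps [simp]:
  "queue_of (st\<lparr>QP := q\<rparr>) = (queue_of st)(prim st := q)"
  "queue_of (st\<lparr>QS := q\<rparr>) = (queue_of st)(other (prim st) := q)"
  "queue_of (st\<lparr>Q := q\<rparr>) = queue_of st"
  "queue_of (st\<lparr>onP := b\<rparr>) = queue_of st"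
  "queue_of (st\<lparr>idleP := i\<rparr>) = queue_of st"
  "queue_of st (prim st) = QP st"
  "queue_of st (other (prim st)) = QS st"
  by (auto simp: queue_of_def fun_eq_iff neq_machine_iff)

lemma on_of_simps [simp]:
  "on_of (st\<lparr>QP := q\<rparr>) = on_of st"
  "on_of (st\<lparr>QS := q\<rparr>) = on_of st"
  "on_of (st\<lparr>Q := q\<rparr>) = on_of st"
  "on_of (st\<lparr>idleP := i\<rparr>) = on_of st"
  "on_of (st\<lparr>onP := b\<rparr>) = (on_of st)(prim st := b)"
  by (auto simp: on_of_def fun_eq_iff)

lemma budget_simps [simp]:
  "budget \<psi> (st\<lparr>QP := q\<rparr>) = budget \<psi> st"
  "budget \<psi> (st\<lparr>QS := q\<rparr>) = budget \<psi> st"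
  "budget \<psi> (st\<lparr>Q := q\<rparr>) = budget \<psi> st"
  by (auto simp: budget_def fun_eq_iff)

context online_run
begin

lemma core_enqueue:
  assumes core: "core X Y st D I C" and j: "j \<in> Y" "arr j = clock st"
    and st': "clock st' = clock st" "wf_state \<psi> st'" "Q st = []" "Q st' = []"
      "queue_of st' = (queue_of st)(m := enqueue j (queue_of st m))"
    and feas: "edf_feasible (enqueue j (queue_of st m)) (clock st)"
    and D': "\<And>m. finite (D' m)" "\<And>m. D m \<subseteq> D' m" "\<And>m. on_of st' m \<Longrightarrow> on_of st m \<or> clock st \<in> D' m"
    and C': "(\<Sum>m\<in>UNIV. card (D' m) + \<psi> * (I m + budget \<psi> st' m)) \<le> C'"
  shows "core (insert j X) (Y - {j}) st' D' I C'"
proof (rule core_arrive[OF core j st'(1,2) _ _ D' C'])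
  show "edf_feasible (queue_of st' m') (clock st)" for m'
    using core feas by (simp add: st'(5) core_def)
  show "Q st' = enqueue j (Q st) \<and> prim st' = prim st \<and> (\<forall>m. queue_of st' m = queue_of st m) \<or>
      Q st = [] \<and> Q st' = [] \<and> (\<exists>m. queue_of st' m = enqueue j (queue_of st m) \<and>
         (\<forall>m'. m' \<noteq> m \<longrightarrow> queue_of st' m' = queue_of st m'))"
    using st'(3-5) by (intro disjI2 conjI exI[of _ m]) auto
qed

section \<open>Phases\<close>

text \<open>U is fixed as the set of future jobs when the previous phase ends. It stays the same
  while Y shrinks and enters the log when the next phase starts.\<close>

definition phase_off :: "job set \<Rightarrow> job set \<Rightarrow> state \<Rightarrow> (job set \<times> real \<times> real) list \<Rightarrow> bool" where
  "phase_off X Y st ps \<longleftrightarrow>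
     valid_log \<psi> J ps \<and> \<not> onP st \<and> \<not> onS st \<and> \<not> urgent (1/2) (Q st) (clock st) \<and>
     (\<exists>U. Y \<subseteq> U \<and> U \<subseteq> J \<and> (\<forall>x. W (Q st) x \<le> due (U \<inter> X) x) \<and>
        separated \<psi> U ps)"

text \<open>
  Before the names are swapped for the first time in a phase, and afterwards; \<open>r\<close> is the number
  of times that the primary machine was turned on again in the current phase.
\<close>

definition phase_pre :: "job set \<Rightarrow> job set \<Rightarrow> state \<Rightarrow> (job set \<times> real \<times> real) list \<Rightarrow> bool" where
  "phase_pre X Y st ps \<longleftrightarrow>
     valid_log \<psi> J ps \<and> onP st \<and> \<not> onS st \<and>
     (\<exists>U \<tau> ps'. ps = (U, \<tau>, 0) # ps' \<and> Y \<subseteq> U \<and> \<tau> + idleP st \<le> clock st \<and>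
        (\<forall>x. fresh X (QP st) (clock st) x \<or> idleP st = 0 \<and> loaded U X \<tau> (QP st) (clock st) x))"

definition phase_post :: "job set \<Rightarrow> job set \<Rightarrow> state \<Rightarrow> (job set \<times> real \<times> real) list \<Rightarrow> bool" where
  "phase_post X Y st ps \<longleftrightarrow>
     valid_log \<psi> J ps \<and> (onP st \<or> onS st) \<and>
     (\<exists>U \<tau> r ps'. ps = (U, \<tau>, 1 + 3 * real r) # ps' \<and> Y \<subseteq> U \<and>
        \<tau> + 2 * real r / \<psi> + (if onP st then idleP st else 2 / \<psi>) \<le> clock st \<and>
        (\<forall>x. fresh X (QP st) (clock st) x) \<and>
        (\<forall>x. fresh X (QS st) (clock st) x \<or> loaded U X \<tau> (QS st) (clock st) x))"

text \<open>The log already contains the running phase, so its cost is accounted for from the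
  start.\<close>

definition inv :: "job set \<Rightarrow> job set \<Rightarrow> state \<Rightarrow> bool" where
  "inv X Y st \<longleftrightarrow> (\<exists>D I ps. core X Y st D I (log_cost ps) \<and>
     (phase_off X Y st ps \<or> phase_pre X Y st ps \<or> phase_post X Y st ps))"

text \<open>The entry of the running phase is revised in place: a swap raises \<kappa> from 0 to 1
  and every later turn-on adds 3. Separation restrains an entry only once a newer one
  exists.\<close>

lemma valid_log_update:
  assumes "valid_log \<psi> J ((U, \<tau>, \<kappa>) # ps)" "x - \<tau> \<le> due U x" "\<kappa>' / 2 \<le> x - \<tau>" "0 < \<kappa>'"
  shows "valid_log \<psi> J ((U, \<tau>, \<kappa>') # ps)"
  using assms by auto

lemma core_facts:
  assumes "core X Y st D I C"
  shows "wf_state \<psi> st" "X \<subseteq> J" "Y \<subseteq> J" "X \<inter> Y = {}" "finite X" "\<forall>j\<in>X. 0 < proc j"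
proof -
  show "X \<subseteq> J" using assms by (auto simp: core_def)
  then show "finite X" "\<forall>j\<in>X. 0 < proc j" using proc_pos by (auto intro: finite_subset)
qed (use assms in \<open>auto simp: core_def\<close>)

section \<open>Progress and end of a running phase\<close>

lemma phase_pre_work:
  assumes core: "core X Y st D I C" and ph: "phase_pre X Y st ps"
    and t: "clock st \<le> t" "\<forall>j\<in>Y. t \<le> arr j"
  shows "phase_pre X Y (work_until \<psi> t st) ps \<or> phase_off X Y (work_until \<psi> t st) ps"
proof -
  let ?c = "clock st" and ?st = "work_until \<psi> t st"
  note cf = core_facts[OF core]
  from ph obtain U \<tau> ps' where ps: "ps = (U, \<tau>, 0) # ps'" "Y \<subseteq> U" "\<tau> + idleP st \<le> ?c"
    and fr: "\<And>x. fresh X (QP st) ?c x \<or> idleP st = 0 \<and> loaded U X \<tau> (QP st) ?c x"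
    and v: "valid_log \<psi> J ps" and on: "onP st" "\<not> onS st"
    by (auto simp: phase_pre_def)
  have wf: "wf_queue (QP st)" "Q st = []" "0 \<le> idleP st" using cf(1) on by (auto simp: wf_state_def)
  have wl: "0 \<le> workload (QP st)" using wf(1) by (rule workload_nonneg)
  have s: "clock ?st = t" "QP ?st = serve (t - ?c) (QP st)" "\<not> onS ?st" "Q ?st = []"
    "idleP ?st = idleP st + max 0 (t - ?c - workload (QP st))"
    "onP ?st \<longleftrightarrow> idleP ?st \<le> 2 / \<psi>"
    using on wf by (auto simp: work_until_def Let_def)
  have time: "\<tau> + idleP ?st \<le> t" using ps(3) wl t(1) unfolding s by (auto simp: max_def)
  show ?thesis
  proof (cases "onP ?st")
    case True
    have "fresh X (QP ?st) t x \<or> idleP ?st = 0 \<and> loaded U X \<tau> (QP ?st) t x" for x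
    proof (cases "fresh X (QP st) ?c x")
      case True
      then show ?thesis unfolding s using fresh_serve[OF cf(6) wf(1) t(1)] by blast
    next
      case False
      then have 0: "idleP st = 0" "loaded U X \<tau> (QP st) ?c x" using fr by auto
      show ?thesis
      proof (cases "W (QP st) x \<le> t - ?c")
        case True
        then show ?thesis unfolding s using loaded_serve[OF cf(6) wf(1) t(1) 0(2)] by auto
      next
        case False
        then show ?thesis
          unfolding s using loaded_serve[OF cf(6) wf(1) t(1) 0(2)] 0 workload_ge_W[OF wf(1), of x] by auto
      qed
    qed
    then have "phase_pre X Y ?st ps" unfolding phase_pre_def using v True s(1,3) ps(1,2) time by auto
    then show ?thesis ..
  next
    case False
    \<comment> \<open>The phase has outlasted the idle allowance \<open>2 / \<psi>\<close>.
      Subtracting the margin leaves 4 - \<psi> on the right, which is at least 3.\<close>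
    have "3 + 0 \<le> 2 * \<psi> * (arr j - \<tau> - 1/2)" if "j \<in> Y" for j
    proof -
      have "2 / \<psi> < arr j - \<tau>" using False s(6) time t(2) that by fastforce
      then have "2 \<le> \<psi> * (arr j - \<tau>)" using psi by (simp add: divide_less_eq mult.commute)
      then show ?thesis using psi by (simp add: algebra_simps)
    qed
    moreover have "0 \<le> due (Y \<inter> X) x" for x using cf by (intro due_nonneg) auto
    ultimately have "phase_off X Y ?st ps"
      unfolding phase_off_def using v False s cf(3) ps
      by (auto simp: urgent_iff intro!: exI[of _ Y])
    then show ?thesis ..
  qed
qed

lemma phase_post_work:
  assumes core: "core X Y st D I C" and ph: "phase_post X Y st ps"
    and t: "clock st \<le> t" "\<forall>j\<in>Y. t \<le> arr j"
  shows "phase_post X Y (work_until \<psi> t st) ps \<or> phase_off X Y (work_until \<psi> t st) ps"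
proof -
  let ?c = "clock st" and ?st = "work_until \<psi> t st"
  note cf = core_facts[OF core]
  from ph obtain U \<tau> r ps' where ps: "ps = (U, \<tau>, 1 + 3 * real r) # ps'" "Y \<subseteq> U"
      "\<tau> + 2 * real r / \<psi> + (if onP st then idleP st else 2 / \<psi>) \<le> ?c"
    and fr: "\<And>x. fresh X (QP st) ?c x" "\<And>x. fresh X (QS st) ?c x \<or> loaded U X \<tau> (QS st) ?c x"
    and v: "valid_log \<psi> J ps" and on: "onP st \<or> onS st"
    by (auto simp: phase_post_def)
  have wf: "wf_queue (QP st)" "wf_queue (QS st)" "Q st = []" using cf(1) on by (auto simp: wf_state_def)
  have wl: "0 \<le> workload (QP st)" using wf(1) by (rule workload_nonneg)
  have s: "clock ?st = t" "QP ?st = serve (t - ?c) (QP st)" "QS ?st = serve (t - ?c) (QS st)" "Q ?st = []"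
    "idleP ?st = idleP st + max 0 (t - ?c - workload (QP st))"
    "onP ?st \<longleftrightarrow> onP st \<and> idleP ?st \<le> 2 / \<psi>"
    using wf by (auto simp: work_until_def Let_def)
  have time: "\<tau> + 2 * real r / \<psi> + (if onP ?st then idleP ?st else 2 / \<psi>) \<le> t"
    using ps(3) wl t(1) unfolding s by (auto simp: max_def split: if_splits)
  show ?thesis
  proof (cases "onP ?st \<or> onS ?st")
    case True
    have "fresh X (QP ?st) t x" for x unfolding s using fresh_serve[OF cf(6) wf(1) t(1)] fr(1) by blast
    moreover have "fresh X (QS ?st) t x \<or> loaded U X \<tau> (QS ?st) t x" for x
      unfolding s using fresh_serve[OF cf(6) wf(2) t(1)] loaded_serve[OF cf(6) wf(2) t(1)] fr(2) by blast
    ultimately have "phase_post X Y ?st ps"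
      unfolding phase_post_def using v True s(1) ps(1,2) time by auto
    then show ?thesis ..
  next
    case False
    \<comment> \<open>Since \<tau> the primary machine has used up r + 1 allowances, so the
      right-hand side is at least 4 * r + 4. No margin is subtracted, as
      \<open>first U \<le> \<tau>\<close> after a swap.\<close>
    have "3 + (1 + 3 * real r) \<le> 2 * \<psi> * (arr j - \<tau> - 0)" if "j \<in> Y" for j
    proof -
      have "t \<le> arr j" using t(2) that by blast
      then have "2 * real r / \<psi> + 2 / \<psi> \<le> arr j - \<tau>" using False time by simp
      then have "(2 * real r + 2) / \<psi> \<le> arr j - \<tau>" by (simp add: add_divide_distrib)
      then have "2 * real r + 2 \<le> \<psi> * (arr j - \<tau>)" using psi by (simp add: divide_le_eq mult.commute)
      then show ?thesis by (simp add: algebra_simps)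
    qed
    moreover have "0 \<le> due (Y \<inter> X) x" for x using cf by (intro due_nonneg) auto
    ultimately have "phase_off X Y ?st ps"
      unfolding phase_off_def using v False s cf(3) ps
      by (auto simp: urgent_iff intro!: exI[of _ Y])
    then show ?thesis ..
  qed
qed

lemma inv_work_until:
  assumes core: "core X Y st D I (log_cost ps)" and ph: "phase_pre X Y st ps \<or> phase_post X Y st ps"
    and t: "clock st \<le> t" "\<forall>j\<in>Y. t \<le> arr j"
    and sch: "\<And>m s. clock st \<le> s \<Longrightarrow> s < t \<Longrightarrow> sch m s = run (queue_of st m) (budget \<psi> st m) (clock st) s"
  shows "inv X Y (work_until \<psi> t st)"
  using core_work_until[OF core t sch] ph phase_pre_work[OF core _ t] phase_post_work[OF core _ t]
  unfolding inv_def by blast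

text \<open>\<open>slack\<close> concerns the jobs pending before the start, \<open>demand\<close>
  all of U: an arriving job that causes the urgency counts for the latter but is not in
  \<open>Q st\<close> yet. By \<open>slack\<close>, pending work is due at least 1/2 after the
  start, which \<open>loaded\<close> records for a possible swap.\<close>

lemma phase_start:
  assumes core: "core X Y st D I (log_cost ps)" and off: "\<not> onP st" "\<not> onS st"
    and v: "valid_log \<psi> J ps" and U: "Y \<subseteq> U" "U \<subseteq> J" "\<forall>x. W (Q st) x \<le> due (U \<inter> X) x"
      "separated \<psi> U ps"
    and slack: "\<And>x. 0 < W (Q st) x \<Longrightarrow> W (Q st) x \<le> x - clock st - 1/2"
    and demand: "0 < due U y" "y - (clock st + 1/2) \<le> due U y"
  shows "\<exists>D ps. core X Y (rule_1a st) D I (log_cost ps) \<and> phase_pre X Y (rule_1a st) ps"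
proof -
  let ?c = "clock st" and ?ps = "(U, clock st, 0) # ps"
  note cf = core_facts[OF core]
  have "edf_feasible (Q st) ?c"
    unfolding edf_feasible_def
  proof
    fix x show "W (Q st) x \<le> max 0 (x - ?c)"
      using slack[of x] by (cases "0 < W (Q st) x") auto
  qed
  from core_start[OF core off this] obtain D' where "core X Y (rule_1a st) D' I (log_cost ?ps)"
    by (auto simp: add.commute)
  moreover have "valid_log \<psi> J ?ps" using v U(2,4) demand by auto
  moreover have "fresh X (Q st) ?c x \<or> loaded U X ?c (Q st) ?c x" for x
  proof (cases "0 < W (Q st) x")
    case True
    then show ?thesis using slack[OF True] U(3) by (simp add: loaded_def)
  next
    case False
    then show ?thesis using cf(6) by (intro disjI1 fresh_zero) auto
  qed
  ultimately show ?thesis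
    using off U(1) by (intro exI[of _ D'] exI[of _ ?ps]) (auto simp: phase_pre_def rule_1a_def)
qed

text \<open>A refusal exhibits some x at which the queue including j is too full to be fresh.
  Enqueueing j preserves freshness, so the queue was not fresh before; hence it was loaded, and the
  excess over \<open>x - c\<close> adds up with \<open>c - \<tau>\<close> to the claimed
  demand.\<close>

lemma overload:
  assumes X: "insert j X \<subseteq> J" "j \<notin> X" "arr j = c" and U: "j \<in> U" "U \<subseteq> J"
    and fr: "\<And>x. fresh X q c x \<or> loaded U X \<tau> q c x"
    and na: "\<not> available q c j"
  shows "\<exists>x. \<not> fresh X q c x \<and> c \<le> x \<and> \<tau> + 1/2 \<le> x \<and> x - \<tau> \<le> due U x"
proof -
  have fin: "finite X" using X finite_subset[of X J] by auto
  obtain x where x: "c \<le> x" "x - c < W (enqueue j q) x" using na by (auto simp: available_def)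
  then have "max 0 (x - c) < W (enqueue j q) x" by simp
  then have "\<not> fresh (insert j X) (enqueue j q) c x" by (rule not_fresh[OF X(1)])
  then have nf: "\<not> fresh X q c x" using fresh_enqueue[OF fin X(2,3)] by blast
  then have "loaded U X \<tau> q c x" using fr by blast
  then have "loaded U (insert j X) \<tau> (enqueue j q) c x" using loaded_enqueue[OF fin X(2) U(1)] by blast
  then have l: "\<tau> + 1/2 \<le> x" "W (enqueue j q) x + (c - \<tau>) \<le> due (U \<inter> insert j X) x"
    by (auto simp: loaded_def)
  have "due (U \<inter> insert j X) x \<le> due U x"
    using U(2) finite_subset[OF U(2)] proc_pos by (intro due_mono) auto
  then show ?thesis using nf x l by (intro exI[of _ x]) auto
qed

lemma available_fresh:
  assumes "insert j X \<subseteq> J" "j \<notin> X" "arr j = c" "\<And>x. fresh X q c x"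
  shows "available q c j"
proof (rule ccontr)
  assume "\<not> available q c j"
  then show False
    \<comment> \<open>The queue is fresh everywhere, so the \<open>loaded\<close> alternative is
      vacuous and the instances \<open>J\<close> and \<open>c\<close> serve only to fill its
      parameters.\<close>
    using overload[of j X c J q "c"] assms by auto
qed

section \<open>Arrivals\<close>

lemma inv_1b_pre:
  assumes core: "core X Y st D I (log_cost ps)" and ph: "phase_pre X Y st ps"
    and j: "j \<in> Y" "arr j = clock st"
  shows "inv (insert j X) (Y - {j}) (rule_1b j st)"
proof -
  let ?c = "clock st"
  note cf = core_facts[OF core]
  have jX: "j \<notin> X" "j \<in> J" "insert j X \<subseteq> J" "0 < proc j" "\<forall>i\<in>insert j X. 0 < proc i"
    using cf j proc_pos by auto
  from ph obtain U \<tau> ps' where ps: "ps = (U, \<tau>, 0) # ps'" "Y \<subseteq> U" "\<tau> + idleP st \<le> ?c"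
    and fr: "\<And>x. fresh X (QP st) ?c x \<or> idleP st = 0 \<and> loaded U X \<tau> (QP st) ?c x"
    and v: "valid_log \<psi> J ps" and on: "onP st" "\<not> onS st"
    by (auto simp: phase_pre_def)
  have wf: "wf_queue (QP st)" "wf_queue (QS st)" "QS st = []" "Q st = []" "0 \<le> idleP st" "idleP st \<le> 2 / \<psi>"
    using cf(1) on by (auto simp: wf_state_def)
  have jU: "j \<in> U" "U \<subseteq> J" using j ps v by auto
  have feas: "edf_feasible (queue_of st m) ?c" for m using core by (simp add: core_def)
  have feasP: "edf_feasible (QP st) ?c" using feas[of "prim st"] by (simp add: queue_of_def)
  have hist: "finite (D m)" for m using core by (simp add: core_def history_def)
  have C: "(\<Sum>m\<in>UNIV. card (D m) + \<psi> * (I m + budget \<psi> st m)) \<le> log_cost ps"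
    using core by (simp add: core_def)
  show ?thesis
  proof (cases "available (QP st) ?c j")
    case True
    let ?st = "st\<lparr>QP := enqueue j (QP st)\<rparr>"
    have eq: "rule_1b j st = ?st" using True by (simp add: rule_1b_def)
    have "core (insert j X) (Y - {j}) ?st D I (log_cost ps)"
    proof (rule core_enqueue[OF core j, where m = "prim st"])
      show "wf_state \<psi> ?st" using cf(1) on jX by (auto simp: wf_state_def wf_queue_enqueue)
      show "edf_feasible (enqueue j (queue_of st (prim st))) ?c"
        using available_feasible[of "QP st" j] feasP True jX j by simp
    qed (use hist wf C in auto)
    moreover have "fresh (insert j X) (enqueue j (QP st)) ?c x
        \<or> idleP st = 0 \<and> loaded U (insert j X) \<tau> (enqueue j (QP st)) ?c x" for x
      using fr[of x] fresh_enqueue[OF cf(5) jX(1) j(2)] loaded_enqueue[OF cf(5) jX(1) jU(1)] by blast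
    then have "phase_pre (insert j X) (Y - {j}) ?st ps"
      unfolding phase_pre_def using v on ps by auto
    ultimately show ?thesis unfolding eq inv_def by blast
  next
    case False
    let ?st = "st\<lparr>prim := other (prim st), onS := True, QS := QP st, QP := enqueue j [], idleP := 0\<rparr>"
    let ?D = "D(other (prim st) := insert ?c (D (other (prim st))))"
    have eq: "rule_1b j st = ?st" using False by (simp add: rule_1b_def)
    obtain x where x: "\<not> fresh X (QP st) ?c x" "?c \<le> x" "\<tau> + 1/2 \<le> x" "x - \<tau> \<le> due U x"
      using overload[OF jX(3,1) j(2) jU, of "QP st" \<tau>] fr False by blast
    have idle: "idleP st = 0" using fr[of x] x(1) by auto
    let ?ps = "(U, \<tau>, 1 + 3 * real 0) # ps'"
    have v': "valid_log \<psi> J ?ps"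
      by (rule valid_log_update[OF v[unfolded ps(1)] x(4)]) (use x(3) in simp_all)
    have fr0: "fresh (insert j X) (enqueue j []) ?c y" for y
      using cf by (intro fresh_enqueue fresh_zero) (use jX j in auto)
    have feasj: "edf_feasible (enqueue j []) ?c"
      using fresh_feasible[OF jX(3) _ fr0] jX by (simp add: wf_queue_enqueue)
    have "card (?D (other (prim st))) \<le> Suc (card (D (other (prim st))))"
      by (simp add: card_insert_if hist)
    then have card: "real (card (insert ?c (D (other (prim st))))) \<le> 1 + real (card (D (other (prim st))))"
      by simp
    have "core (insert j X) (Y - {j}) ?st ?D I (log_cost ?ps)"
    proof (rule core_enqueue[OF core j, where m = "other (prim st)"])
      show "wf_state \<psi> ?st" using cf(1) on jX psi by (auto simp: wf_state_def wf_queue_enqueue)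
      show "edf_feasible (enqueue j (queue_of st (other (prim st)))) ?c"
        using feasj wf by simp
      show "queue_of ?st = (queue_of st)(other (prim st) := enqueue j (queue_of st (other (prim st))))"
        using wf by (auto simp: queue_of_def fun_eq_iff neq_machine_iff)
      show "on_of st m \<or> ?c \<in> ?D m" for m
        using on by (auto simp: on_of_def neq_machine_iff)
      show "(\<Sum>m\<in>UNIV. card (?D m) + \<psi> * (I m + budget \<psi> ?st m)) \<le> log_cost ?ps"
        using C card idle on unfolding sum_machine_other[where m = "prim st"] ps(1)
        by (simp add: budget_def algebra_simps)
    qed (use hist wf in auto)
    moreover have "fresh (insert j X) (QP st) ?c y \<or> loaded U (insert j X) \<tau> (QP st) ?c y" for y
      using fr[of y] fresh_insert[OF cf(5) jX(5)] loaded_insert[OF cf(5) jX(5)] by blast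
    then have "phase_post (insert j X) (Y - {j}) ?st ?ps"
      unfolding phase_post_def using v' on ps idle fr0 by (auto intro!: exI[of _ "0::nat"])
    ultimately show ?thesis unfolding eq inv_def by blast
  qed
qed

text \<open>The new primary queue is fresh for every deadline and so never refuses a job. This
  excludes a second swap in the phase.\<close>

lemma inv_1b_post:
  assumes core: "core X Y st D I (log_cost ps)" and ph: "phase_post X Y st ps" "\<not> onS st"
    and j: "j \<in> Y" "arr j = clock st"
  shows "inv (insert j X) (Y - {j}) (rule_1b j st)"
proof -
  let ?c = "clock st" and ?st = "st\<lparr>QP := enqueue j (QP st)\<rparr>"
  note cf = core_facts[OF core]
  have jX: "j \<notin> X" "j \<in> J" "insert j X \<subseteq> J" "0 < proc j" "\<forall>i\<in>insert j X. 0 < proc i"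
    using cf j proc_pos by auto
  from ph obtain U \<tau> r ps' where ps: "ps = (U, \<tau>, 1 + 3 * real r) # ps'" "Y \<subseteq> U"
      "\<tau> + 2 * real r / \<psi> + idleP st \<le> ?c"
    and fr: "\<And>x. fresh X (QP st) ?c x" "\<And>x. fresh X (QS st) ?c x \<or> loaded U X \<tau> (QS st) ?c x"
    and v: "valid_log \<psi> J ps" and on: "onP st" "\<not> onS st"
    by (auto simp: phase_post_def)
  have wf: "wf_queue (QP st)" "QS st = []" "Q st = []"
    using cf(1) on by (auto simp: wf_state_def)
  have hist: "finite (D m)" for m using core by (simp add: core_def history_def)
  have C: "(\<Sum>m\<in>UNIV. card (D m) + \<psi> * (I m + budget \<psi> st m)) \<le> log_cost ps"
    using core by (simp add: core_def)
  have eq: "rule_1b j st = ?st"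
    using available_fresh[OF jX(3,1) j(2) fr(1)] by (simp add: rule_1b_def)
  have fr': "fresh (insert j X) (enqueue j (QP st)) ?c x" for x
    using fresh_enqueue[OF cf(5) jX(1) j(2) fr(1)] .
  have "edf_feasible (enqueue j (QP st)) ?c"
    using fresh_feasible[OF jX(3) _ fr'] jX wf by (simp add: wf_queue_enqueue)
  moreover have "wf_state \<psi> ?st" using cf(1) on jX by (auto simp: wf_state_def wf_queue_enqueue)
  ultimately have "core (insert j X) (Y - {j}) ?st D I (log_cost ps)"
    using C hist wf by (intro core_enqueue[OF core j, where m = "prim st"]) auto
  moreover have "fresh (insert j X) (QS st) ?c y \<or> loaded U (insert j X) \<tau> (QS st) ?c y" for y
    using fr(2)[of y] fresh_insert[OF cf(5) jX(5)] loaded_insert[OF cf(5) jX(5)] by blast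
  then have "phase_post (insert j X) (Y - {j}) ?st ps"
    unfolding phase_post_def using v on ps fr' by auto
  ultimately show ?thesis unfolding eq inv_def by blast
qed

text \<open>A job refused by the secondary machine needs no test on the primary one, whose queue
  stays fresh and hence EDF-feasible.\<close>

lemma inv_1c:
  assumes core: "core X Y st D I (log_cost ps)" and ph: "phase_post X Y st ps" "onS st"
    and j: "j \<in> Y" "arr j = clock st"
  shows "inv (insert j X) (Y - {j}) (rule_1c j st)"
proof -
  let ?c = "clock st"
  note cf = core_facts[OF core]
  have jX: "j \<notin> X" "j \<in> J" "insert j X \<subseteq> J" "0 < proc j" "\<forall>i\<in>insert j X. 0 < proc i"
    using cf j proc_pos by auto
  from ph obtain U \<tau> r ps' where ps: "ps = (U, \<tau>, 1 + 3 * real r) # ps'" "Y \<subseteq> U"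
      "\<tau> + 2 * real r / \<psi> + (if onP st then idleP st else 2 / \<psi>) \<le> ?c"
    and fr: "\<And>x. fresh X (QP st) ?c x" "\<And>x. fresh X (QS st) ?c x \<or> loaded U X \<tau> (QS st) ?c x"
    and v: "valid_log \<psi> J ps" and on: "onS st"
    by (auto simp: phase_post_def)
  have wf: "wf_queue (QP st)" "wf_queue (QS st)" "Q st = []"
    using cf(1) on by (auto simp: wf_state_def)
  have jU: "j \<in> U" "U \<subseteq> J" using j ps v by auto
  have feas: "edf_feasible (queue_of st m) ?c" for m using core by (simp add: core_def)
  have feasS: "edf_feasible (QS st) ?c" using feas[of "other (prim st)"] by (simp add: queue_of_def)
  have hist: "finite (D m)" for m using core by (simp add: core_def history_def)
  have C: "(\<Sum>m\<in>UNIV. card (D m) + \<psi> * (I m + budget \<psi> st m)) \<le> log_cost ps"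
    using core by (simp add: core_def)
  have frS: "fresh (insert j X) (QS st) ?c y \<or> loaded U (insert j X) \<tau> (QS st) ?c y" for y
    using fr(2)[of y] fresh_insert[OF cf(5) jX(5)] loaded_insert[OF cf(5) jX(5)] by blast
  have frS': "fresh (insert j X) (enqueue j (QS st)) ?c y \<or> loaded U (insert j X) \<tau> (enqueue j (QS st)) ?c y" for y
    using fr(2)[of y] fresh_enqueue[OF cf(5) jX(1) j(2)] loaded_enqueue[OF cf(5) jX(1) jU(1)] by blast
  have frP: "fresh (insert j X) (QP st) ?c x" for x
    using fresh_insert[OF cf(5) jX(5) fr(1)] .
  have frP': "fresh (insert j X) (enqueue j (QP st)) ?c x" for x
    using fresh_enqueue[OF cf(5) jX(1) j(2) fr(1)] .
  have feasP': "edf_feasible (enqueue j (QP st)) ?c"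
    using fresh_feasible[OF jX(3) _ frP'] jX wf by (simp add: wf_queue_enqueue)
  show ?thesis
  proof (cases "available (QS st) ?c j")
    case True
    let ?st = "st\<lparr>QS := enqueue j (QS st)\<rparr>"
    have eq: "rule_1c j st = ?st" using True by (simp add: rule_1c_def)
    have "edf_feasible (enqueue j (QS st)) ?c"
      using available_feasible[of "QS st" j] feasS True jX j by auto
    moreover have "wf_state \<psi> ?st" using cf(1) on jX by (auto simp: wf_state_def wf_queue_enqueue)
    ultimately have "core (insert j X) (Y - {j}) ?st D I (log_cost ps)"
      using C hist wf by (intro core_enqueue[OF core j, where m = "other (prim st)"]) auto
    moreover have "phase_post (insert j X) (Y - {j}) ?st ps"
      unfolding phase_post_def using v on ps frP frS' by auto
    ultimately show ?thesis unfolding eq inv_def by blast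
  next
    case na: False
    show ?thesis
    proof (cases "onP st")
      case True
      let ?st = "st\<lparr>QP := enqueue j (QP st)\<rparr>"
      have eq: "rule_1c j st = ?st" using na True by (simp add: rule_1c_def)
      have "wf_state \<psi> ?st" using cf(1) True jX by (auto simp: wf_state_def wf_queue_enqueue)
      then have "core (insert j X) (Y - {j}) ?st D I (log_cost ps)"
        using C hist wf feasP' by (intro core_enqueue[OF core j, where m = "prim st"]) auto
      moreover have "phase_post (insert j X) (Y - {j}) ?st ps"
        unfolding phase_post_def using v on ps frP' frS True by auto
      ultimately show ?thesis unfolding eq inv_def by blast
    next
      case False
      let ?st = "st\<lparr>QP := enqueue j (QP st), onP := True, idleP := 0\<rparr>"
      let ?D = "D(prim st := insert ?c (D (prim st)))"
      let ?ps = "(U, \<tau>, 1 + 3 * real (Suc r)) # ps'"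
      have eq: "rule_1c j st = ?st" using na False by (simp add: rule_1c_def)
      obtain x where x: "?c \<le> x" "x - \<tau> \<le> due U x"
        using overload[OF jX(3,1) j(2) jU, of "QS st" \<tau>] fr(2) na by blast
      have time: "\<tau> + 2 * real (Suc r) / \<psi> \<le> ?c"
        using ps(3) False by (simp add: add_divide_distrib algebra_simps)
      \<comment> \<open>\<kappa> rises to 4 + 3 * r. The refusal yields a demand up to some x \<ge>
        \<open>?c\<close>, and r + 1 full allowances have passed since \<tau>, so
        \<open>x - \<tau>\<close> is at least 2 * r + 2, which is at least half of the new
        \<kappa>.\<close>
      have "2 * real (Suc r) \<le> 2 * real (Suc r) / \<psi>"
        using psi by (simp add: le_divide_eq mult_left_le)
      then have "(1 + 3 * real (Suc r)) / 2 \<le> x - \<tau>" using time x by simp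
      then have v': "valid_log \<psi> J ?ps"
        by (rule valid_log_update[OF v[unfolded ps(1)] x(2)]) simp
      have "card (?D (prim st)) \<le> Suc (card (D (prim st)))"
        by (simp add: card_insert_if hist)
      then have card: "real (card (insert ?c (D (prim st)))) \<le> 1 + real (card (D (prim st)))"
        by simp
      have "core (insert j X) (Y - {j}) ?st ?D I (log_cost ?ps)"
      proof (rule core_enqueue[OF core j, where m = "prim st"])
        show "wf_state \<psi> ?st" using cf(1) on jX psi by (auto simp: wf_state_def wf_queue_enqueue)
        show "(\<Sum>m\<in>UNIV. card (?D m) + \<psi> * (I m + budget \<psi> ?st m)) \<le> log_cost ?ps"
          using C card False psi unfolding sum_machine_other[where m = "prim st"] ps(1)
          by (simp add: budget_def algebra_simps)
      qed (use hist wf feasP' in \<open>auto split: if_splits\<close>)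
      moreover have "phase_post (insert j X) (Y - {j}) ?st ?ps"
        unfolding phase_post_def using v' on ps frP' frS time by (auto intro!: exI[of _ "Suc r"])
      ultimately show ?thesis unfolding eq inv_def by blast
    qed
  qed
qed

lemma inv_arrive:
  assumes inv: "inv X Y st" and j: "j \<in> Y" "arr j = clock st"
  shows "inv (insert j X) (Y - {j}) (arrive (1/2) j st)"
proof -
  from inv obtain D I ps where core: "core X Y st D I (log_cost ps)"
    and ph: "phase_off X Y st ps \<or> phase_pre X Y st ps \<or> phase_post X Y st ps"
    by (auto simp: inv_def)
  let ?c = "clock st"
  note cf = core_facts[OF core]
  from ph show ?thesis
  proof (elim disjE)
    assume pre: "phase_pre X Y st ps"
    then have "arrive (1/2) j st = rule_1b j st" by (simp add: arrive_def phase_pre_def)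
    then show ?thesis using inv_1b_pre[OF core pre j] by simp
  next
    assume post: "phase_post X Y st ps"
    then show ?thesis
    proof (cases "onS st")
      case True
      then have "arrive (1/2) j st = rule_1c j st" by (simp add: arrive_def)
      then show ?thesis using inv_1c[OF core post True j] by simp
    next
      case False
      then have "arrive (1/2) j st = rule_1b j st" using post by (auto simp: arrive_def phase_post_def)
      then show ?thesis using inv_1b_post[OF core post False j] by simp
    qed
  next
    assume off: "phase_off X Y st ps"
    then have o: "\<not> onP st" "\<not> onS st" "valid_log \<psi> J ps" and nu: "\<not> urgent (1/2) (Q st) ?c"
      by (auto simp: phase_off_def)
    from off obtain U where U: "Y \<subseteq> U" "U \<subseteq> J" "\<forall>x. W (Q st) x \<le> due (U \<inter> X) x"
      "separated \<psi> U ps"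
      unfolding phase_off_def by blast
    have jX: "j \<notin> X" "j \<in> J" "0 < proc j" using cf j proc_pos by auto
    have wf: "wf_queue (Q st)" using cf(1) by (simp add: wf_state_def)
    have wf': "wf_queue (enqueue j (Q st))" using wf jX by (simp add: wf_queue_enqueue)
    have "U \<inter> insert j X = insert j (U \<inter> X)" using U j by auto
    then have W': "W (enqueue j (Q st)) x \<le> due (U \<inter> insert j X) x" for x
      using U(3) jX cf(5) by (simp add: due_insert W_enqueue)
    show ?thesis
    proof (cases "urgent (1/2) (enqueue j (Q st)) ?c")
      case True
      then have eq: "arrive (1/2) j st = rule_1b j (rule_1a st)" using o by (simp add: arrive_def)
      obtain y where y: "0 < W (enqueue j (Q st)) y" "y - W (enqueue j (Q st)) y - 1/2 \<le> ?c"
        using True urgent_iff[OF wf'] by blast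
      have "due (U \<inter> insert j X) y \<le> due U y"
        using U(2) finite_subset[OF U(2)] proc_pos by (intro due_mono) auto
      then have "0 < due U y" "y - (?c + 1/2) \<le> due U y" using y W'[of y] by auto
      moreover have "W (Q st) x \<le> x - ?c - 1/2" if "0 < W (Q st) x" for x
        using nu that urgent_iff[OF wf, of "1/2" ?c] by force
      ultimately obtain D' ps' where "core X Y (rule_1a st) D' I (log_cost ps')"
        "phase_pre X Y (rule_1a st) ps'"
        using phase_start[OF core o U] by blast
      then show ?thesis unfolding eq using j by (intro inv_1b_pre) (auto simp: rule_1a_def)
    next
      case False
      let ?st = "st\<lparr>Q := enqueue j (Q st)\<rparr>"
      have eq: "arrive (1/2) j st = ?st" using o False by (simp add: arrive_def)
      have "core (insert j X) (Y - {j}) ?st D I (log_cost ps)"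
      proof (rule core_arrive[OF core j])
        show "wf_state \<psi> ?st" using cf(1) o wf' by (auto simp: wf_state_def)
        show "edf_feasible (queue_of ?st m) ?c" for m
          using core by (simp add: core_def)
        show "finite (D m)" for m using core by (simp add: core_def history_def)
        show "(\<Sum>m\<in>UNIV. card (D m) + \<psi> * (I m + budget \<psi> ?st m)) \<le> log_cost ps"
          using core by (simp add: core_def)
      qed auto
      moreover have "phase_off (insert j X) (Y - {j}) ?st ps"
        unfolding phase_off_def using o False U W' by (auto intro!: exI[of _ U])
      ultimately show ?thesis unfolding eq inv_def by blast
    qed
  qed
qed

section \<open>Time without arrivals\<close>

lemma elapse_off_Nil:
  assumes "\<not> onP st" "\<not> onS st" "Q st = []"
  shows "elapse \<psi> u s st = st\<lparr>clock := s\<rparr>"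
  using assms by (auto simp: elapse_def urgent_iff)

lemma elapse_off:
  assumes "wf_queue (Q st)" "\<not> onP st" "\<not> onS st" "Q st \<noteq> []" "\<not> urgent u (Q st) (clock st)"
  obtains \<tau> where "clock st < \<tau>" "\<And>s. urgent u (Q st) s \<longleftrightarrow> \<tau> \<le> s"
    "\<And>s. s < \<tau> \<Longrightarrow> elapse \<psi> u s st = st\<lparr>clock := s\<rparr>"
    "\<And>s. \<tau> \<le> s \<Longrightarrow> elapse \<psi> u s st = work_until \<psi> s (rule_1a (st\<lparr>clock := \<tau>\<rparr>))"
proof -
  obtain \<tau> where \<tau>: "\<And>s. urgent u (Q st) s \<longleftrightarrow> \<tau> \<le> s"
    using urgent_threshold[OF assms(1,4), of u] by blast
  have less: "clock st < \<tau>" using assms(5) \<tau> by auto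
  have "{s. clock st \<le> s \<and> \<tau> \<le> s} = {\<tau>..}" using less by auto
  then have "Inf {s. clock st \<le> s \<and> \<tau> \<le> s} = \<tau>" by simp
  then have "elapse \<psi> u s st = work_until \<psi> s (rule_1a (st\<lparr>clock := \<tau>\<rparr>))" if "\<tau> \<le> s" for s
    using assms that less by (auto simp: elapse_def \<tau>)
  moreover have "elapse \<psi> u s st = st\<lparr>clock := s\<rparr>" if "s < \<tau>" for s
    using assms that by (auto simp: elapse_def \<tau>)
  ultimately show thesis using that less \<tau> by blast
qed

lemma start_when_urgent:
  assumes core: "core X Y st D I (log_cost ps)" and off: "phase_off X Y st ps"
    and \<tau>: "clock st < \<tau>" "\<And>s. urgent (1/2) (Q st) s \<longleftrightarrow> \<tau> \<le> s" "\<forall>j\<in>Y. \<tau> \<le> arr j"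
    and sleep: "\<And>m s. clock st \<le> s \<Longrightarrow> s < \<tau> \<Longrightarrow> sch m s = Sleep"
  obtains D' I' ps' where "core X Y (rule_1a (st\<lparr>clock := \<tau>\<rparr>)) D' I' (log_cost ps')"
    "phase_pre X Y (rule_1a (st\<lparr>clock := \<tau>\<rparr>)) ps'"
proof -
  let ?st = "st\<lparr>clock := \<tau>\<rparr>"
  note cf = core_facts[OF core]
  have wf: "wf_queue (Q st)" using cf(1) by (simp add: wf_state_def)
  from off have o: "\<not> onP st" "\<not> onS st" "valid_log \<psi> J ps" by (auto simp: phase_off_def)
  from off obtain U where U: "Y \<subseteq> U" "U \<subseteq> J" "\<forall>x. W (Q st) x \<le> due (U \<inter> X) x"
      "separated \<psi> U ps"
    unfolding phase_off_def by blast
  obtain I' where core': "core X Y ?st D I' (log_cost ps)"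
    using core_wait[OF core o(1,2) less_imp_le[OF \<tau>(1)] \<tau>(3) sleep] by blast
  have "urgent (1/2) (Q st) \<tau>" using \<tau>(2) by simp
  then obtain y where y: "0 < W (Q st) y" "y - W (Q st) y - 1/2 \<le> \<tau>" using urgent_iff[OF wf] by blast
  have "due (U \<inter> X) y \<le> due U y"
    using U(2) finite_subset[OF U(2)] proc_pos by (intro due_mono) auto
  then have dem: "0 < due U y" "y - (clock ?st + 1/2) \<le> due U y" using y U(3)[rule_format, of y] by auto
  have slack: "W (Q ?st) x \<le> x - clock ?st - 1/2" if "0 < W (Q ?st) x" for x
  proof -
    \<comment> \<open>The work due by x becomes urgent at this time at the latest, and \<tau> is the
      earliest moment of urgency.\<close>
    have "urgent (1/2) (Q st) (x - W (Q st) x - 1/2)" using urgent_iff[OF wf] that by auto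
    then show ?thesis using \<tau>(2) by simp
  qed
  have o': "\<not> onP ?st" "\<not> onS ?st" "\<forall>x. W (Q ?st) x \<le> due (U \<inter> X) x" using o U by auto
  from phase_start[OF core' o'(1,2) o(3) U(1,2) o'(3) U(4) slack dem] that show thesis by blast
qed

lemma mode_elapse_on:
  assumes "wf_state \<psi> st" "onP st \<or> onS st" "clock st \<le> s"
    and "sch m s = mode_of (switch_off \<psi> (elapse \<psi> (1/2) s st)) m"
  shows "sch m s = run (queue_of st m) (budget \<psi> st m) (clock st) s"
  using assms mode_of_work_until[OF assms(1,3)] by (simp add: elapse_def)

lemma on_phase: "phase_pre X Y st ps \<or> phase_post X Y st ps \<Longrightarrow> onP st \<or> onS st"
  by (auto simp: phase_pre_def phase_post_def)

text \<open>The mode at t itself is left open, because arrivals at t may still change it.\<close>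

lemma inv_elapse:
  assumes inv: "inv X Y st" and t: "clock st \<le> t" "\<forall>j\<in>Y. t \<le> arr j"
    and sch: "\<And>m s. clock st \<le> s \<Longrightarrow> s < t \<Longrightarrow> sch m s = mode_of (switch_off \<psi> (elapse \<psi> (1/2) s st)) m"
  shows "inv X Y (elapse \<psi> (1/2) t st)"
proof -
  from inv obtain D I ps where core: "core X Y st D I (log_cost ps)"
    and ph: "phase_off X Y st ps \<or> phase_pre X Y st ps \<or> phase_post X Y st ps"
    by (auto simp: inv_def)
  note cf = core_facts[OF core]
  show ?thesis
  proof (cases "phase_off X Y st ps")
    case False
    then have on: "onP st \<or> onS st" using ph on_phase by blast
    then have "elapse \<psi> (1/2) t st = work_until \<psi> t st" by (simp add: elapse_def)
    then show ?thesis
      using inv_work_until[OF core _ t] mode_elapse_on[OF cf(1) on] sch ph False by metis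
  next
    case off: True
    then have o: "\<not> onP st" "\<not> onS st" and nu: "\<not> urgent (1/2) (Q st) (clock st)"
      by (auto simp: phase_off_def)
    have wf: "wf_queue (Q st)" using cf(1) by (simp add: wf_state_def)
    have wait: "inv X Y (st\<lparr>clock := t\<rparr>)"
      if sl: "\<And>m s. clock st \<le> s \<Longrightarrow> s < t \<Longrightarrow> sch m s = Sleep" and "\<not> urgent (1/2) (Q st) t"
    proof -
      have "\<exists>I'. core X Y (st\<lparr>clock := t\<rparr>) D I' (log_cost ps)" by (rule core_wait[OF core o t sl])
      moreover have "phase_off X Y (st\<lparr>clock := t\<rparr>) ps" using off that(2) by (auto simp: phase_off_def)
      ultimately show ?thesis unfolding inv_def by blast
    qed
    show ?thesis
    proof (cases "Q st = []")
      case True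
      note el = elapse_off_Nil[OF o True]
      show ?thesis unfolding el
        using True sch o by (intro wait) (auto simp: el mode_of_off[OF cf(1) o] urgent_iff)
    next
      case False
      from elapse_off[OF wf o False nu] obtain \<tau> where \<tau>: "clock st < \<tau>"
        "\<And>s. urgent (1/2) (Q st) s \<longleftrightarrow> \<tau> \<le> s"
        "\<And>s. s < \<tau> \<Longrightarrow> elapse \<psi> (1/2) s st = st\<lparr>clock := s\<rparr>"
        "\<And>s. \<tau> \<le> s \<Longrightarrow> elapse \<psi> (1/2) s st = work_until \<psi> s (rule_1a (st\<lparr>clock := \<tau>\<rparr>))"
        by blast
      have sleep: "sch m s = Sleep" if "clock st \<le> s" "s < t" "s < \<tau>" for m s
        using sch[OF that(1,2)] \<tau>(3)[OF that(3)] mode_of_off[OF cf(1) o] by simp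
      show ?thesis
      proof (cases "t < \<tau>")
        case True
        then show ?thesis unfolding \<tau>(3)[OF True] using sleep \<tau>(2) by (intro wait) auto
      next
        case False
        then have \<tau>t: "\<tau> \<le> t" by simp
        let ?st = "rule_1a (st\<lparr>clock := \<tau>\<rparr>)"
        have c: "clock ?st = \<tau>" by (simp add: rule_1a_def)
        have "\<forall>j\<in>Y. \<tau> \<le> arr j" using t \<tau>t by fastforce
        then obtain D' I' ps' where n: "core X Y ?st D' I' (log_cost ps')" "phase_pre X Y ?st ps'"
          using start_when_urgent[OF core off \<tau>(1,2)] sleep \<tau>t by (metis order_less_le_trans)
        have "inv X Y (work_until \<psi> t ?st)"
        proof (rule inv_work_until[OF n(1)])
          show "sch m s = run (queue_of ?st m) (budget \<psi> ?st m) (clock ?st) s"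
            if "clock ?st \<le> s" "s < t" for m s
            using sch[of s m] that c \<tau>(1) \<tau>(4)[of s] mode_of_work_until[OF core_facts(1)[OF n(1)], of s m]
            by simp
        qed (use n t \<tau>t c in auto)
        then show ?thesis unfolding \<tau>(4)[OF \<tau>t] .
      qed
    qed
  qed
qed

text \<open>A moment from which both machines sleep and nothing is left in any queue: there the
  statements of \<open>core\<close> about the past become statements about the whole
  schedule.\<close>

definition final :: bool where
  "final \<longleftrightarrow> (\<exists>st D I ps. core J {} st D I (log_cost ps) \<and> valid_log \<psi> J ps \<and> Q st = [] \<and>
     (\<forall>m. queue_of st m = []) \<and> (\<forall>m s. clock st \<le> s \<longrightarrow> sch m s = Sleep))"

lemma final_if_on:
  assumes core: "core J {} st D I (log_cost ps)" and ph: "phase_pre J {} st ps \<or> phase_post J {} st ps"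
    and sch: "\<And>m s. clock st \<le> s \<Longrightarrow> sch m s = run (queue_of st m) (budget \<psi> st m) (clock st) s"
  shows final
proof -
  let ?e = "\<lambda>m. workload (queue_of st m) + budget \<psi> st m"
  \<comment> \<open>By T both machines have emptied their queues and used up their idle
    allowances.\<close>
  define T where "T = clock st + (\<Sum>m\<in>UNIV. ?e m)"
  note cf = core_facts[OF core]
  have e: "0 \<le> workload (queue_of st m)" "0 \<le> budget \<psi> st m" for m
    using workload_nonneg[OF wf_queue_of[OF cf(1)]] budget_nonneg[OF cf(1)] by auto
  have "clock st + ?e m \<le> T" for m
    using e(1)[of M1] e(1)[of M2] e(2)[of M1] e(2)[of M2]
    unfolding T_def sum_machine by (cases m) auto
  then have T: "clock st \<le> T" "\<And>m. clock st + workload (queue_of st m) + budget \<psi> st m \<le> T"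
    using e by (auto simp: T_def sum_nonneg add.assoc)
  obtain I' where "core J {} (work_until \<psi> T st) D I' (log_cost ps)"
    using core_work_until[OF core T(1)] sch by blast
  moreover have "valid_log \<psi> J ps" using ph by (auto simp: phase_pre_def phase_post_def)
  moreover have "Q (work_until \<psi> T st) = []"
    using on_phase[OF ph] cf(1) by (auto simp: work_until_def wf_state_def Let_def)
  moreover have "queue_of (work_until \<psi> T st) m = []" for m
  proof -
    have "serve (T - clock st) (queue_of st m) = []"
      using serve_eq_Nil_iff[OF wf_queue_of[OF cf(1)]] T(1) T(2)[of m] e(2)[of m] by auto
    then show ?thesis by (simp add: queue_of_work_until)
  qed
  moreover have "sch m s = Sleep" if "clock (work_until \<psi> T st) \<le> s" for m s
  proof -
    have "T \<le> s" using that by (simp add: work_until_def Let_def)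
    then show ?thesis
      using sch[of s m] T(1) T(2)[of m] run_eq_Sleep_iff[OF wf_queue_of[OF cf(1)] e(2)[of m], of "clock st" s m]
      by simp
  qed
  ultimately show ?thesis unfolding final_def by blast
qed

lemma final_if_inv:
  assumes inv: "inv J {} st"
    and sch: "\<And>m s. clock st \<le> s \<Longrightarrow> sch m s = mode_of (switch_off \<psi> (elapse \<psi> (1/2) s st)) m"
  shows final
proof -
  from inv obtain D I ps where core: "core J {} st D I (log_cost ps)"
    and ph: "phase_off J {} st ps \<or> phase_pre J {} st ps \<or> phase_post J {} st ps"
    by (auto simp: inv_def)
  note cf = core_facts[OF core]
  show ?thesis
  proof (cases "phase_off J {} st ps")
    case False
    then have on: "phase_pre J {} st ps \<or> phase_post J {} st ps" using ph by blast
    show ?thesis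
      using final_if_on[OF core on] mode_elapse_on[OF cf(1) on_phase[OF on]] sch by blast
  next
    case off: True
    then have o: "\<not> onP st" "\<not> onS st" and nu: "\<not> urgent (1/2) (Q st) (clock st)"
      and v: "valid_log \<psi> J ps"
      by (auto simp: phase_off_def)
    have wf: "wf_queue (Q st)" using cf(1) by (simp add: wf_state_def)
    show ?thesis
    proof (cases "Q st = []")
      case True
      have "queue_of st m = []" for m using cf(1) o by (auto simp: wf_state_def queue_of_def)
      moreover have "sch m s = Sleep" if "clock st \<le> s" for m s
        using sch[OF that] elapse_off_Nil[OF o True] mode_of_off[OF cf(1) o] by simp
      ultimately show ?thesis using core v True unfolding final_def by blast
    next
      case False
      from elapse_off[OF wf o False nu] obtain \<tau> where \<tau>: "clock st < \<tau>"
        "\<And>s. urgent (1/2) (Q st) s \<longleftrightarrow> \<tau> \<le> s"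
        "\<And>s. s < \<tau> \<Longrightarrow> elapse \<psi> (1/2) s st = st\<lparr>clock := s\<rparr>"
        "\<And>s. \<tau> \<le> s \<Longrightarrow> elapse \<psi> (1/2) s st = work_until \<psi> s (rule_1a (st\<lparr>clock := \<tau>\<rparr>))"
        by blast
      let ?st = "rule_1a (st\<lparr>clock := \<tau>\<rparr>)"
      have c: "clock ?st = \<tau>" by (simp add: rule_1a_def)
      have sleep: "sch m s = Sleep" if "clock st \<le> s" "s < \<tau>" for m s
        using sch[OF that(1)] \<tau>(3)[OF that(2)] mode_of_off[OF cf(1) o] by simp
      obtain D' I' ps' where n: "core J {} ?st D' I' (log_cost ps')" "phase_pre J {} ?st ps'"
        using start_when_urgent[OF core off \<tau>(1,2) _ sleep] by auto
      have "sch m s = run (queue_of ?st m) (budget \<psi> ?st m) (clock ?st) s" if "clock ?st \<le> s" for m s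
        using sch[of s m] that c \<tau>(1) \<tau>(4)[of s] mode_of_work_until[OF core_facts(1)[OF n(1)], of s m]
        by simp
      then show ?thesis using final_if_on[OF n(1)] n(2) by blast
    qed
  qed
qed

section \<open>Prefixes of the input and the complete schedule\<close>

abbreviation "process \<equiv> fold (\<lambda>j st. arrive (1/2) j (elapse \<psi> (1/2) (arr j) st))"

text \<open>The clock of \<open>init\<close> is 0, but arrival times may be negative, whereas
  \<open>core\<close> wants no future job to precede the clock. Starting at the first arrival does
  not affect the modes, since \<open>elapse\<close> overwrites the clock while everything is
  off.\<close>

abbreviation "start \<equiv> init m\<^sub>0\<lparr>clock := if js = [] then 0 else arr (hd js)\<rparr>"

lemma elapse_init: "elapse \<psi> u s (init m\<^sub>0\<lparr>clock := c\<rparr>) = init m\<^sub>0\<lparr>clock := s\<rparr>"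
  by (simp add: elapse_off_Nil init_def)

lemma elapse_init': "elapse \<psi> u s (init m\<^sub>0) = init m\<^sub>0\<lparr>clock := s\<rparr>"
  by (simp add: elapse_off_Nil init_def)

lemma elapse_process_init: "elapse \<psi> u s (process xs (init m\<^sub>0)) = elapse \<psi> u s (process xs start)"
  by (cases xs) (simp_all add: elapse_init elapse_init')

lemma sch_eq:
  assumes "js = xs @ ys" "\<forall>j\<in>set xs. arr j \<le> s" "\<forall>j\<in>set ys. s < arr j"
  shows "sch m s = mode_of (switch_off \<psi> (elapse \<psi> (1/2) s (process xs start))) m"
proof -
  have "filter (\<lambda>j. arr j \<le> s) js = xs"
    using assms by (auto simp: filter_empty_conv not_le)
  then show ?thesis
    using elapse_process_init[of "1/2" s xs]
    by (simp add: algA_def state_at_def Let_def mode_of_def on_of_def queue_of_def)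
qed

lemma clock_elapse: "clock (elapse \<psi> u t st) = t"
  by (simp add: elapse_def work_until_def Let_def)

lemma inv_start: "inv {} J start"
proof -
  let ?c = "if js = [] then 0 else arr (hd js)"
  have first: "?c \<le> arr j" if "j \<in> J" for j
  proof (cases js)
    case (Cons i is')
    then show ?thesis using seq that by (auto simp: job_sequence_def)
  qed (use that in simp)
  have sleep: "sch m s = Sleep" if "s < ?c" for m s
  proof -
    have "\<forall>j\<in>J. s < arr j" using first that by fastforce
    then have "sch m s = mode_of (switch_off \<psi> (elapse \<psi> (1/2) s start)) m"
      using sch_eq[of "[]" js s m] by simp
    also have "\<dots> = Sleep"
      unfolding elapse_init by (simp add: mode_of_def on_of_def switch_off_def init_def current_mode_def)
    finally show ?thesis .
  qed
  have "cut ?c (sch m) = (\<lambda>_. Sleep)" for m using sleep by (auto simp: cut_def)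
  moreover have "step_fun (\<lambda>_. Sleep)" unfolding step_fun_def by blast
  ultimately have step: "step_fun (cut ?c (sch m))" for m by simp
  have "turn_ons (sch m) \<inter> {..<?c} = {}" for m using sleep by (auto simp: turn_ons_def)
  moreover have "{t. t < ?c \<and> sch m t = Idle} = {}" for m using sleep by auto
  then have "emeasure lborel {t. t < ?c \<and> sch m t = Idle} = 0" for m by (simp only: emeasure_empty)
  ultimately have hist: "history ?c False (sch m) {} 0" for m
    unfolding history_def using step by (simp only: finite.emptyI ennreal_0) simp
  have "core {} J start (\<lambda>_. {}) (\<lambda>_. 0) (log_cost [])"
    unfolding core_def using first hist sleep
    by (auto simp: init_def wf_state_def queue_of_def on_of_def edf_feasible_def budget_def)
  moreover have "phase_off {} J start []"
    by (auto simp: phase_off_def init_def urgent_iff due_def)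
  ultimately show ?thesis unfolding inv_def by blast
qed

lemma inv_process:
  "js = xs @ ys \<Longrightarrow> inv (set xs) (set ys) (process xs start)"
proof (induction xs arbitrary: ys rule: rev_induct)
  case Nil
  then show ?case using inv_start by simp
next
  case (snoc j xs)
  let ?st = "process xs start"
  have js: "js = xs @ j # ys" using snoc.prems by simp
  have IH: "inv (set xs) (set (j # ys)) ?st" by (rule snoc.IH) (use js in simp)
  then obtain D I C where core: "core (set xs) (set (j # ys)) ?st D I C" by (auto simp: inv_def)
  have c: "clock ?st \<le> arr j" "\<forall>i\<in>set xs. arr i \<le> clock ?st" using core by (auto simp: core_def)
  have later: "\<forall>i\<in>set (j # ys). arr j \<le> arr i"
    using seq unfolding js job_sequence_def by (auto simp: sorted_append)
  have "inv (set xs) (set (j # ys)) (elapse \<psi> (1/2) (arr j) ?st)"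
  proof (rule inv_elapse[OF IH c(1) later])
    \<comment> \<open>If j arrives together with its predecessor, this range is empty, so states
      between simultaneous arrivals never show in the schedule.\<close>
    show "sch m s = mode_of (switch_off \<psi> (elapse \<psi> (1/2) s ?st)) m"
      if "clock ?st \<le> s" "s < arr j" for m s
      by (rule sch_eq[OF js]) (use that c later in force)+
  qed
  then have "inv (insert j (set xs)) (set (j # ys) - {j}) (arrive (1/2) j (elapse \<psi> (1/2) (arr j) ?st))"
    by (rule inv_arrive) (auto simp: clock_elapse)
  moreover have "set (j # ys) - {j} = set ys"
    using seq unfolding js job_sequence_def by auto
  ultimately show ?case by simp
qed

lemma final: final
proof (rule final_if_inv)
  have inv: "inv J {} (process js start)" using inv_process[of js "[]"] by simp
  then show "inv J {} (process js start)" .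
  from inv obtain D I C where "core J {} (process js start) D I C" by (auto simp: inv_def)
  then have "\<forall>j\<in>J. arr j \<le> clock (process js start)" by (simp add: core_def)
  then show "sch m s = mode_of (switch_off \<psi> (elapse \<psi> (1/2) s (process js start))) m"
    if "clock (process js start) \<le> s" for m s
    using that by (intro sch_eq) fastforce+
qed

lemma feasible_and_energy:
  obtains ps where "valid_log \<psi> J ps" "feasible J sch"
    "energy \<psi> sch \<le> ennreal ((\<Sum>j\<in>J. proc j) + log_cost ps)"
proof -
  obtain st D I ps where core: "core J {} st D I (log_cost ps)" and v: "valid_log \<psi> J ps"
    and Q: "Q st = []" "\<And>m. queue_of st m = []" and sleep: "\<And>m s. clock st \<le> s \<Longrightarrow> sch m s = Sleep"
    using final unfolding final_def by blast
  let ?c = "clock st"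
  have hist: "history ?c (on_of st m) (sch m) (D m) (I m)" for m using core by (simp add: core_def)
  have "cut ?c (sch m) = sch m" for m using sleep by (auto simp: cut_def not_less)
  then have step: "step_fun (sch m)" for m using hist[of m] by (simp add: history_def)
  have before: "t < ?c" if "sch m t \<noteq> Sleep" for m t using sleep[of t m] that by (meson not_less)
  have busyD: "j \<in> J \<and> t \<in> {arr j..dl j}" if "sch m t = Busy j" for m t j
    using core before[of m t] that by (simp add: core_def)
  have cutB: "{t. t < ?c \<and> sch m t = Busy j} = {t. sch m t = Busy j}" for m j
    using before[of m] by auto
  have own: "\<exists>m. emeasure lborel {t. sch m t = Busy j} = ennreal (proc j) \<and>
                 (\<forall>m'. m' \<noteq> m \<longrightarrow> (\<forall>t. sch m' t \<noteq> Busy j))" if "j \<in> J" for j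
  proof -
    have "\<exists>m. owns st sch j m" using core that by (simp add: core_def)
    then obtain m where m: "owns st sch j m" ..
    have "sch m' t \<noteq> Busy j" if "m' \<noteq> m" for m' t
      using m that before[of m' t] by (auto simp: owns_def)
    then show ?thesis using m Q cutB[of m j] by (auto simp: owns_def)
  qed
  have feas: "feasible J sch" unfolding feasible_def using step busyD own by blast
  have sets: "{t. sch m t = w} \<in> sets borel" for m w
    using step_fun_sets[OF step, of "\<lambda>v. v = w"] .
  have busy: "emeasure lborel {t. \<exists>j. sch m t = Busy j} = (\<Sum>j\<in>J. emeasure lborel {t. sch m t = Busy j})" for m
  proof -
    have "{t. \<exists>j. sch m t = Busy j} = (\<Union>j\<in>J. {t. sch m t = Busy j})" using busyD by auto
    then show ?thesis
      using sets by (simp add: sum_emeasure[symmetric] disjoint_family_on_def image_subset_iff disjoint_iff)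
  qed
  have "(\<Sum>m\<in>UNIV. emeasure lborel {t. \<exists>j. sch m t = Busy j})
      = (\<Sum>j\<in>J. \<Sum>m\<in>UNIV. emeasure lborel {t. sch m t = Busy j})"
    unfolding busy by (rule sum.swap)
  also have "\<dots> = (\<Sum>j\<in>J. ennreal (proc j))"
  proof (rule sum.cong)
    fix j assume "j \<in> J"
    then obtain m where m: "emeasure lborel {t. sch m t = Busy j} = ennreal (proc j)"
      "\<And>m' t. m' \<noteq> m \<Longrightarrow> sch m' t \<noteq> Busy j" using own by blast
    then have "{t. sch (other m) t = Busy j} = {}" by auto
    then show "(\<Sum>m\<in>UNIV. emeasure lborel {t. sch m t = Busy j}) = ennreal (proc j)"
      unfolding sum_machine_other[where m = m] m(1) by simp
  qed simp
  also have "\<dots> = ennreal (\<Sum>j\<in>J. proc j)"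
    using proc_pos by (intro sum_ennreal) (auto intro: less_imp_le)
  finally have work: "(\<Sum>m\<in>UNIV. emeasure lborel {t. \<exists>j. sch m t = Busy j}) = ennreal (\<Sum>j\<in>J. proc j)" .
  have I: "0 \<le> I m" for m using hist[of m] by (simp add: history_def)
  have idle: "emeasure lborel {t. sch m t = Idle} = ennreal (I m)" for m
  proof -
    have "{t. t < ?c \<and> sch m t = Idle} = {t. sch m t = Idle}" using before[of m] by auto
    then show ?thesis using hist[of m] by (simp add: history_def)
  qed
  have ons: "card (turn_ons (sch m)) \<le> card (D m)" for m
  proof (rule card_mono)
    show "finite (D m)" using hist[of m] by (simp add: history_def)
    have "turn_ons (sch m) \<subseteq> {..<?c}" using before[of m] by (auto simp: turn_ons_def)
    then show "turn_ons (sch m) \<subseteq> D m" using hist[of m] by (auto simp: history_def)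
  qed
  have rest: "of_nat (card (turn_ons (sch m))) + ennreal \<psi> * emeasure lborel {t. sch m t = Idle}
      \<le> ennreal (card (D m) + \<psi> * (I m + budget \<psi> st m))" for m
  proof -
    have "of_nat (card (turn_ons (sch m))) + ennreal \<psi> * emeasure lborel {t. sch m t = Idle}
      = ennreal (card (turn_ons (sch m)) + \<psi> * I m)"
      unfolding idle using psi I[of m]
      by (simp add: ennreal_of_nat_eq_real_of_nat ennreal_mult[symmetric] ennreal_plus[symmetric] del: ennreal_plus)
    also have "\<dots> \<le> ennreal (card (D m) + \<psi> * (I m + budget \<psi> st m))"
      using ons[of m] psi budget_nonneg[OF core_facts(1)[OF core], of m]
      by (intro ennreal_leI add_mono mult_left_mono) auto
    finally show ?thesis .
  qed
  have "energy \<psi> sch = (\<Sum>m\<in>UNIV. emeasure lborel {t. \<exists>j. sch m t = Busy j})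
     + (\<Sum>m\<in>UNIV. of_nat (card (turn_ons (sch m))) + ennreal \<psi> * emeasure lborel {t. sch m t = Idle})"
    unfolding energy_def machine_energy_def by (simp add: sum.distrib algebra_simps)
  also have "\<dots> \<le> ennreal (\<Sum>j\<in>J. proc j)
     + (\<Sum>m\<in>UNIV. ennreal (card (D m) + \<psi> * (I m + budget \<psi> st m)))"
    unfolding work using rest by (intro add_left_mono sum_mono)
  also have "(\<Sum>m\<in>UNIV. ennreal (card (D m) + \<psi> * (I m + budget \<psi> st m)))
     = ennreal (\<Sum>m\<in>UNIV. card (D m) + \<psi> * (I m + budget \<psi> st m))"
    using psi I budget_nonneg[OF core_facts(1)[OF core]] by (intro sum_ennreal) auto
  also have "\<dots> \<le> ennreal (log_cost ps)" using core by (intro ennreal_leI) (simp add: core_def)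
  also have "ennreal (\<Sum>j\<in>J. proc j) + ennreal (log_cost ps) = ennreal ((\<Sum>j\<in>J. proc j) + log_cost ps)"
  proof (rule ennreal_plus[symmetric])
    show "0 \<le> (\<Sum>j\<in>J. proc j)" using proc_pos by (intro sum_nonneg) (auto intro: less_imp_le)
    have "0 \<le> (\<Sum>m\<in>UNIV. card (D m) + \<psi> * (I m + budget \<psi> st m))"
      using psi I budget_nonneg[OF core_facts(1)[OF core]] by (intro sum_nonneg) auto
    also have "\<dots> \<le> log_cost ps" using core by (simp add: core_def)
    finally show "0 \<le> log_cost ps" .
  qed
  finally have "energy \<psi> sch \<le> ennreal ((\<Sum>j\<in>J. proc j) + log_cost ps)" by (simp add: add_left_mono)
  then show thesis using that v feas by blast
qed

end

theorem theorem2: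
  fixes \<psi> :: real and js :: "job list" and m :: machine
  assumes "0 < \<psi>" and "\<psi> \<le> 1"
    and "job_sequence js"
    and "single_machine_schedulable (set js)"
  shows "feasible (set js) (algA \<psi> (1/2) m js) \<and>
         energy \<psi> (algA \<psi> (1/2) m js) \<le> 3 * opt_energy \<psi> (set js)"
proof -
  interpret online_run \<psi> js m using assms by unfold_locales
  obtain ps where ps: "valid_log \<psi> (set js) ps" "feasible (set js) (algA \<psi> (1/2) m js)"
    "energy \<psi> (algA \<psi> (1/2) m js) \<le> ennreal ((\<Sum>j\<in>set js. proc j) + log_cost ps)"
    by (rule feasible_and_energy)
  note ps(3)
  also have "ennreal ((\<Sum>j\<in>set js. proc j) + log_cost ps) \<le> 3 * opt_energy \<psi> (set js)"
    using assms(1,2) proc_pos ps(1) by (intro opt_energy_ge) auto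
  finally show ?thesis using ps(2) by blast
qed

end
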